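(* Let $k,n$ be positive integers with $k\geq 3$, and write $n=qk+r$ with $0\leq r<k$. Among all (weakly connected) digraphs on $n$ vertices without loops or multiple arcs that contain no directed cycle $\overrightarrow{C_{k+1}}$ of length $k+1$ as a subdigraph, the maximum value of the Laplacian energy is $$\frac{1}{3}n^3+\left(\frac{k}{2}-1\right)n^2+\frac{k^2}{6}n+\frac{2}{3}r^3-\frac{k}{2}r^2-\frac{k^2}{6}r.$$ Moreover, a $\overrightarrow{C_{k+1}}$-free digraph of order $n$ attains this maximum if and only if it is isomorphic to $\overrightarrow{F_{n,k}^{q+1}}$ when $0<r<k$, and to $\overrightarrow{F_{n,k}^{0}}$ when $r=0$.
   Context: For a digraph $G$ on vertices $v_1,\dots,v_n$ (no loops, no multiple arcs), $A(G)$ is the adjacency matrix ($a_{ij}=1$ iff $(v_i,v_j)$ is an arc), $D^+(G)=\mathrm{diag}(d_1^+,\dots,d_n^+)$ is the diagonal matrix of outdegrees, and $L(G)=D^+(G)-A(G)$ is the Laplacian matrix. The Laplacian energy is $LE(G)=\sum_{i=1}^n\lambda_i^2$, where $\lambda_1,\dots,\lambda_n$ are the eigenvalues of $L(G)$; equivalently $LE(G)=\sum_i (d_i^+)^2+c_2$, where $c_2$ is the number of directed closed walks of length $2$ (i.e. $\mathrm{tr}(A^2)$). A digraph is $H$-free if it contains no copy of $H$ as a subdigraph. $\overleftrightarrow{K_m}$ denotes the complete digraph on $m$ vertices (both arcs between every pair of distinct vertices). For disjoint vertex sets $V_i,V_j$, $V_i\mapsto V_j$ means that $(u,v)$ is an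 arc for every $u\in V_i$, $v\in V_j$, and there is no arc from $V_j$ to $V_i$. For $n=qk+r$ with $0<r<k$ and $s\in\{0,1,\dots,q\}$, $\overrightarrow{F_{n,k}^{s+1}}$ is the digraph whose vertex set is partitioned into $V_1,\dots,V_{q+1}$ with $|V_{s+1}|=r$ and $|V_i|=k$ for $i\neq s+1$, such that each induced subdigraph on $V_i$ is a complete digraph and $V_i\mapsto V_j$ for all $1\leq i<j\leq q+1$ (and there are no other arcs). For $r=0$, $\overrightarrow{F_{n,k}^{0}}$ is the digraph with vertex partition $V_1,\dots,V_q$, $|V_i|=k$, each $V_i$ inducing $\overleftrightarrow{K_k}$, and $V_i\mapsto V_j$ for $i<j$. *)

theory Defs
  imports
    "Graph_Theory.Graph_Theory"
    "Jordan_Normal_Form.Char_Poly"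
    "HOL-Computational_Algebra.Computational_Algebra"
begin

section \<open>Laplacian energy\<close>

text \<open>The list \<open>vs\<close> fixes the numbering of the vertices that indexes the rows and columns.\<close>

definition adjacency_mat :: "('a,'b) pre_digraph \<Rightarrow> 'a list \<Rightarrow> complex mat" where
  "adjacency_mat G vs = mat (length vs) (length vs)
     (\<lambda>(i,j). if (vs ! i, vs ! j) \<in> arcs_ends G then 1 else 0)"

definition outdegree_mat :: "('a,'b) pre_digraph \<Rightarrow> 'a list \<Rightarrow> complex mat" where
  "outdegree_mat G vs = mat (length vs) (length vs)
     (\<lambda>(i,j). if i = j then of_nat (out_degree G (vs ! i)) else 0)"

definition laplacian_mat :: "('a,'b) pre_digraph \<Rightarrow> 'a list \<Rightarrow> complex mat" where
  "laplacian_mat G vs = outdegree_mat G vs - adjacency_mat G vs"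

definition vertex_enum :: "('a,'b) pre_digraph \<Rightarrow> 'a list" where
  "vertex_enum G = (SOME vs. distinct vs \<and> set vs = verts G)"

text \<open>
  The eigenvalues are the complex roots of the characteristic polynomial, taken with algebraic
  multiplicity. Renumbering the vertices conjugates the Laplacian matrix by a permutation matrix,
  so the choice made by \<^const>\<open>vertex_enum\<close> is immaterial.
\<close>

definition laplacian_eigenvalues :: "('a,'b) pre_digraph \<Rightarrow> complex multiset" where
  "laplacian_eigenvalues G = proots (char_poly (laplacian_mat G (vertex_enum G)))"

text \<open>
  The sum of the squared eigenvalues is a real number, because the matrix is real; hence the real
  part in this definition loses nothing (see \<open>of_real_laplacian_energy\<close> below).
\<close>

definition laplacian_energy :: "('a,'b) pre_digraph \<Rightarrow> real" where
  "laplacian_energy G = Re (\<Sum>z\<in>#laplacian_eigenvalues G. z\<^sup>2)"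

lemma dim_laplacian_mat:
  "dim_row (laplacian_mat G vs) = length vs" "dim_col (laplacian_mat G vs) = length vs"
  by (auto simp: laplacian_mat_def adjacency_mat_def outdegree_mat_def)

lemma char_poly_laplacian_mat_real:
  "map_poly cnj (char_poly (laplacian_mat G vs)) = char_poly (laplacian_mat G vs)"
proof -
  interpret cnj: comm_ring_hom cnj by unfold_locales auto
  have "laplacian_mat G vs \<in> carrier_mat (length vs) (length vs)"
    by (auto simp: dim_laplacian_mat)
  moreover have "map_mat cnj (laplacian_mat G vs) = laplacian_mat G vs"
    by (rule eq_matI)
      (auto simp: laplacian_mat_def adjacency_mat_def outdegree_mat_def)
  ultimately show ?thesis using cnj.char_poly_hom by metis
qed

lemma proots_cnj:
  assumes "(p :: complex poly) = (\<Prod>a\<leftarrow>as. [:- a, 1:])"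
  shows "proots p = mset as" "proots (map_poly cnj p) = image_mset cnj (mset as)"
proof -
  have *: "proots (\<Prod>a\<leftarrow>bs. [:- a, 1:]) = mset bs" for bs :: "complex list"
    by (induction bs) (simp_all add: proots_mult prod_list_zero_iff image_iff del: mult_pCons_left)
  show "proots p = mset as" using * assms by simp
  interpret cnj: comm_ring_hom cnj by unfold_locales auto
  interpret cp: map_poly_comm_ring_hom cnj ..
  have "map_poly cnj p = (\<Prod>a\<leftarrow>map cnj as. [:- a, 1:])"
    unfolding assms by (simp add: cp.hom_prod_list o_def)
  then show "proots (map_poly cnj p) = image_mset cnj (mset as)" using *[of "map cnj as"] by simp
qed

lemma of_real_laplacian_energy:
  "complex_of_real (laplacian_energy G) = (\<Sum>z\<in>#laplacian_eigenvalues G. z\<^sup>2)"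
proof -
  let ?L = "laplacian_mat G (vertex_enum G)"
  have "?L \<in> carrier_mat (length (vertex_enum G)) (length (vertex_enum G))"
    by (auto simp: dim_laplacian_mat)
  from char_poly_factorized[OF this] obtain as where
    as: "char_poly ?L = (\<Prod>a\<leftarrow>as. [:- a, 1:])" by blast
  have cnj_sum: "(\<Sum>z\<in>#image_mset cnj A. z\<^sup>2) = cnj (\<Sum>z\<in>#A. z\<^sup>2)" for A
    by (induction A) simp_all
  have "image_mset cnj (laplacian_eigenvalues G) = laplacian_eigenvalues G"
    using proots_cnj[OF as] char_poly_laplacian_mat_real[of G "vertex_enum G"]
    by (simp add: laplacian_eigenvalues_def)
  then have "(\<Sum>z\<in>#laplacian_eigenvalues G. z\<^sup>2)
      = (\<Sum>z\<in>#image_mset cnj (laplacian_eigenvalues G). z\<^sup>2)" by simp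
  also have "\<dots> = cnj (\<Sum>z\<in>#laplacian_eigenvalues G. z\<^sup>2)"
    using cnj_sum[of "laplacian_eigenvalues G"] by simp
  finally have "(\<Sum>z\<in>#laplacian_eigenvalues G. z\<^sup>2) \<in> \<real>"
    by (metis Reals_cnj_iff)
  then show ?thesis by (simp add: laplacian_energy_def)
qed

section \<open>Forbidden subdigraphs\<close>

definition is_free_of :: "('a,'b) pre_digraph \<Rightarrow> ('c,'d) pre_digraph \<Rightarrow> bool" where
  "is_free_of G H \<longleftrightarrow> \<not> (\<exists>H'. subgraph H' G \<and> digraph_iso H H')"

definition dicycle :: "nat \<Rightarrow> (nat, nat \<times> nat) pre_digraph" where
  "dicycle m = with_proj \<lparr> pverts = {..<m}, parcs = {(i, Suc i mod m) | i. i < m} \<rparr>"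

section \<open>The extremal digraphs\<close>

text \<open>
  The digraph with vertex partition \<open>V\<^sub>1, \<dots>, V\<^sub>m\<close>, where \<open>V\<^sub>i = {i} \<times> {..<c i}\<close> has \<open>c i\<close> vertices,
  each \<open>V\<^sub>i\<close> induces a complete digraph, and the arcs between different parts are all those from
  \<open>V\<^sub>i\<close> to \<open>V\<^sub>j\<close> with \<open>i < j\<close>.
\<close>

definition block_digraph ::
    "nat \<Rightarrow> (nat \<Rightarrow> nat) \<Rightarrow> (nat \<times> nat, (nat \<times> nat) \<times> (nat \<times> nat)) pre_digraph" where
  "block_digraph m c = with_proj
     (let V = (SIGMA i:{1..m}. {..<c i})
      in \<lparr> pverts = V,
           parcs = {(u, v). u \<in> V \<and> v \<in> V \<and> u \<noteq> v \<and> fst u \<le> fst v} \<rparr>)"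

text \<open>\<open>F_digraph n k t\<close> with \<open>1 \<le> t \<le> n div k + 1\<close> is meant for \<open>\<not> k dvd n\<close>: the exceptional part
  of size \<open>n mod k\<close> is \<open>V\<^sub>t\<close>.\<close>

definition F_digraph ::
    "nat \<Rightarrow> nat \<Rightarrow> nat \<Rightarrow> (nat \<times> nat, (nat \<times> nat) \<times> (nat \<times> nat)) pre_digraph" where
  "F_digraph n k t = block_digraph (n div k + 1) (\<lambda>i. if i = t then n mod k else k)"

text \<open>The case \<open>k dvd n\<close>.\<close>

definition F0_digraph ::
    "nat \<Rightarrow> nat \<Rightarrow> (nat \<times> nat, (nat \<times> nat) \<times> (nat \<times> nat)) pre_digraph" where
  "F0_digraph n k = block_digraph (n div k) (\<lambda>i. k)"

end

theory Submission
  imports Defs "Jordan_Normal_Form.Schur_Decomposition"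
begin

text \<open>
  The Laplacian energy is the trace of the squared Laplacian, that is, the sum of the squared
  outdegrees plus the number of ordered pairs joined by arcs in both directions.

  Let \<open>l\<close> be the largest number at most \<open>k\<close> such that the digraph has an \<open>l\<close>-cycle. A vertex outside
  such a cycle can be inserted into it unless it has at most \<open>l\<close> arcs to and from the cycle. Removing
  the cycle and inducting bounds the number of arcs by that of the extremal digraph. The same induction,
  with attention to how far each step is from equality, shows that a digraph with \<open>q k + r\<close> vertices,
  \<open>0 < r \<le> k\<close>, whose number of arcs is close to this maximum has few nonadjacent pairs inside any set
  of \<open>r\<close> vertices.

  List the vertices by decreasing outdegree. The first \<open>j\<close> vertices have at most as many outgoing arcs
  as in the extremal digraph, because the arcs among them obey the arc bound and at most \<open>j (n - j)\<close>
  arcs leave them. So the extremal outdegree sequence majorizes every other one, and summation by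
  parts bounds the sum of squares. The number of mutual arcs exceeds its extremal value by at most
  the number of (ordered) nonadjacent pairs. These are charged to the slack of the majorization at
  the multiples of \<open>k\<close>, where the extremal sequence drops by \<open>k\<close>: pairs inside a block of \<open>k\<close>
  consecutive vertices by the stability bound, pairs in different blocks because they are missing among
  the \<open>j (n - j)\<close> possible arcs. Equality forces all these slacks to vanish, which determines the digraph.
\<close>

section \<open>Counting arcs and nonadjacent pairs\<close>

text \<open>Integers are used because the quantities built from this are differences. Ordered pairs
  are counted, so a symmetric relation counts every pair inside one set twice.\<close>

definition cnt :: "('a \<Rightarrow> 'a \<Rightarrow> bool) \<Rightarrow> 'a set \<Rightarrow> 'a set \<Rightarrow> int" where
  "cnt R A B = (\<Sum>x\<in>A. \<Sum>y\<in>B. of_bool (R x y))"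

definition nonadj :: "('a \<Rightarrow> 'a \<Rightarrow> bool) \<Rightarrow> 'a \<Rightarrow> 'a \<Rightarrow> bool" where
  "nonadj E x y \<longleftrightarrow> x \<noteq> y \<and> \<not> E x y \<and> \<not> E y x"

declare sum_of_bool_eq [simp del]

lemma cnt_nonneg [simp]: "0 \<le> cnt R A B"
  by (simp add: cnt_def sum_nonneg)

lemma cnt_empty [simp]: "cnt R {} B = 0" "cnt R A {} = 0"
  by (simp_all add: cnt_def)

lemma cnt_union_left:
  "\<lbrakk>finite A; finite B; A \<inter> B = {}\<rbrakk> \<Longrightarrow> cnt R (A \<union> B) C = cnt R A C + cnt R B C"
  by (simp add: cnt_def sum.union_disjoint)

lemma cnt_union_right:
  "\<lbrakk>finite A; finite B; A \<inter> B = {}\<rbrakk> \<Longrightarrow> cnt R C (A \<union> B) = cnt R C A + cnt R C B"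
  by (simp add: cnt_def sum.union_disjoint sum.distrib)

lemma cnt_insert_left:
  "\<lbrakk>finite A; x \<notin> A\<rbrakk> \<Longrightarrow> cnt R (insert x A) B = cnt R {x} B + cnt R A B"
  by (simp add: cnt_def)

lemma cnt_insert_right:
  "\<lbrakk>finite B; x \<notin> B\<rbrakk> \<Longrightarrow> cnt R A (insert x B) = cnt R A {x} + cnt R A B"
  by (simp add: cnt_def sum.distrib)

lemma cnt_sum_left: "cnt R A B = (\<Sum>x\<in>A. cnt R {x} B)"
  by (simp add: cnt_def)

lemma cnt_sum_right: "cnt R A B = (\<Sum>y\<in>B. cnt R A {y})"
  unfolding cnt_def by (subst sum.swap) simp

lemma cnt_split:
  assumes "finite V" "C \<subseteq> V"
  shows "cnt R V V = cnt R C C + cnt R C (V - C) + cnt R (V - C) C + cnt R (V - C) (V - C)"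
proof -
  have V: "V = C \<union> (V - C)" using assms by auto
  have f: "finite C" "finite (V - C)" "C \<inter> (V - C) = {}"
    using assms finite_subset by auto
  have "cnt R V V = cnt R (C \<union> (V - C)) (C \<union> (V - C))" using V by simp
  also have "\<dots> = cnt R C C + cnt R C (V - C) + cnt R (V - C) C + cnt R (V - C) (V - C)"
    using f by (simp only: cnt_union_left cnt_union_right finite_UnI)
  finally show ?thesis .
qed

lemma cnt_le_card: "cnt R A B \<le> int (card A) * int (card B)"
proof -
  have "cnt R A B \<le> (\<Sum>x\<in>A. \<Sum>y\<in>B. 1)"
    unfolding cnt_def by (intro sum_mono) simp
  then show ?thesis by simp
qed

lemma cnt_le_irrefl:
  assumes "finite C" "\<And>x. \<not> R x x"
  shows "cnt R C C \<le> int (card C) * (int (card C) - 1)"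
proof -
  have "cnt R C C \<le> (\<Sum>x\<in>C. \<Sum>y\<in>C. 1 - of_bool (y = x))"
    unfolding cnt_def using assms(2) by (intro sum_mono) auto
  also have "\<dots> = (\<Sum>x\<in>C. int (card C) - 1)"
    using assms(1) by (intro sum.cong) (auto simp: sum_subtractf of_bool_def)
  finally show ?thesis by simp
qed

lemma cnt_mono:
  assumes "finite B" "finite D" "A \<subseteq> B" "C \<subseteq> D"
  shows "cnt R A C \<le> cnt R B D"
proof -
  have "cnt R A C \<le> cnt R A D"
    unfolding cnt_def using assms by (intro sum_mono sum_mono2) auto
  also have "\<dots> \<le> cnt R B D"
    unfolding cnt_def using assms by (intro sum_mono2) (auto intro: sum_nonneg)
  finally show ?thesis .
qed

lemma cnt_eq_0_iff:
  assumes "finite A" "finite B"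
  shows "cnt R A B = 0 \<longleftrightarrow> (\<forall>x\<in>A. \<forall>y\<in>B. \<not> R x y)"
proof -
  have "cnt R A B = 0 \<longleftrightarrow> (\<forall>x\<in>A. (\<Sum>y\<in>B. of_bool (R x y)) = (0::int))"
    unfolding cnt_def using assms by (intro sum_nonneg_eq_0_iff) (auto intro: sum_nonneg)
  also have "\<dots> \<longleftrightarrow> (\<forall>x\<in>A. \<forall>y\<in>B. of_bool (R x y) = (0::int))"
    using assms by (intro ball_cong refl sum_nonneg_eq_0_iff) auto
  finally show ?thesis by (simp add: of_bool_def)
qed

lemma cnt_pos:
  assumes "finite A" "finite B" "x \<in> A" "y \<in> B" "R x y"
  shows "1 \<le> cnt R A B"
  using cnt_eq_0_iff[OF assms(1,2), of R] cnt_nonneg[of R A B] assms(3-5)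
  by (smt (verit, best))

lemma cnt_transpose:
  "(\<And>x y. R x y \<longleftrightarrow> S y x) \<Longrightarrow> cnt R A B = cnt S B A"
  unfolding cnt_def by (subst sum.swap) simp

lemma nonadj_sym: "nonadj E x y \<longleftrightarrow> nonadj E y x"
  by (auto simp: nonadj_def)

lemma cnt_nonadj_sym: "cnt (nonadj E) A B = cnt (nonadj E) B A"
  by (rule cnt_transpose) (rule nonadj_sym)

lemma cnt_nonadj_split:
  assumes "finite V" "C \<subseteq> V"
  shows "cnt (nonadj E) V V =
    cnt (nonadj E) C C + 2 * cnt (nonadj E) (V - C) C + cnt (nonadj E) (V - C) (V - C)"
  using cnt_split[OF assms, of "nonadj E"] cnt_nonadj_sym[of E C "V - C"] by simp

text \<open>Nonadjacency is symmetric and irreflexive, so a pair counts in both orders. This parity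
  turns an upper bound 1 into 0 in the tight case \<open>k = 3\<close>.\<close>

lemma cnt_nonadj_pos_ge_2:
  assumes "finite C" "cnt (nonadj E) C C > 0"
  shows "cnt (nonadj E) C C \<ge> 2"
proof -
  obtain x y where xy: "x \<in> C" "y \<in> C" "nonadj E x y"
    using cnt_eq_0_iff[OF assms(1) assms(1), of "nonadj E"] assms(2) by fastforce
  then have ne: "x \<noteq> y" and yx: "nonadj E y x" by (auto simp: nonadj_def)
  have 1: "1 \<le> cnt (nonadj E) {x} C" "1 \<le> cnt (nonadj E) {y} C"
    using cnt_pos[of "{x}" C x y] cnt_pos[of "{y}" C y x] xy yx assms(1) by auto
  have "cnt (nonadj E) {x, y} C = cnt (nonadj E) {x} C + cnt (nonadj E) {y} C"
    using cnt_union_left[of "{x}" "{y}" "nonadj E" C] ne by (simp add: insert_commute)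
  moreover have "cnt (nonadj E) {x, y} C \<le> cnt (nonadj E) C C"
    using xy assms(1) by (intro cnt_mono) auto
  ultimately show ?thesis using 1 by linarith
qed

definition defect :: "('a \<Rightarrow> 'a \<Rightarrow> bool) \<Rightarrow> 'a set \<Rightarrow> int" where
  "defect E C = int (card C) * (int (card C) - 1) - cnt E C C"

lemma cnt_nonadj_le_defect:
  assumes "finite C" "\<And>x. \<not> E x x"
  shows "cnt (nonadj E) C C \<le> defect E C"
proof -
  have "cnt E C C + cnt (nonadj E) C C = cnt (\<lambda>x y. E x y \<or> nonadj E x y) C C"
    unfolding cnt_def sum.distrib[symmetric] by (intro sum.cong) (auto simp: nonadj_def)
  also have "\<dots> \<le> int (card C) * (int (card C) - 1)"
    using assms by (intro cnt_le_irrefl) (auto simp: nonadj_def)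
  finally show ?thesis by (simp add: defect_def)
qed

lemma defect_nonneg: "\<lbrakk>finite C; \<And>x. \<not> E x x\<rbrakk> \<Longrightarrow> 0 \<le> defect E C"
  using cnt_le_irrefl[of C E] by (simp add: defect_def)

lemma defect_eq_0_iff:
  assumes "finite C" "\<And>x. \<not> E x x"
  shows "defect E C = 0 \<longleftrightarrow> (\<forall>x\<in>C. \<forall>y\<in>C. x \<noteq> y \<longrightarrow> E x y)"
proof -
  have "cnt E C C + cnt (\<lambda>x y. x \<noteq> y \<and> \<not> E x y) C C = cnt (\<lambda>x y. x \<noteq> y) C C"
    unfolding cnt_def sum.distrib[symmetric] using assms by (intro sum.cong) auto
  also have "\<dots> = (\<Sum>x\<in>C. \<Sum>y\<in>C. 1 - of_bool (y = x))"
    unfolding cnt_def by (intro sum.cong) auto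
  also have "\<dots> = (\<Sum>x\<in>C. int (card C) - 1)"
    using assms(1) by (intro sum.cong) (auto simp: sum_subtractf of_bool_def)
  also have "\<dots> = int (card C) * (int (card C) - 1)" by simp
  finally have "defect E C = cnt (\<lambda>x y. x \<noteq> y \<and> \<not> E x y) C C" by (simp add: defect_def)
  then show ?thesis using cnt_eq_0_iff[OF assms(1) assms(1)] by simp blast
qed

section \<open>Cycles\<close>

text \<open>A single vertex counts as a cycle of length 1, so that every nonempty digraph has a cycle.\<close>

definition dcyc :: "('a \<Rightarrow> 'a \<Rightarrow> bool) \<Rightarrow> (nat \<Rightarrow> 'a) \<Rightarrow> nat \<Rightarrow> bool" where
  "dcyc E c m \<longleftrightarrow> inj_on c {..<m} \<and> (m = 1 \<or> (\<forall>i<m. E (c i) (c (Suc i mod m))))"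

definition cycle_free :: "('a \<Rightarrow> 'a \<Rightarrow> bool) \<Rightarrow> 'a set \<Rightarrow> nat \<Rightarrow> bool" where
  "cycle_free E V m \<longleftrightarrow> \<not> (\<exists>c. dcyc E c m \<and> c ` {..<m} \<subseteq> V)"

lemma cycle_free_subset: "\<lbrakk>cycle_free E V m; W \<subseteq> V\<rbrakk> \<Longrightarrow> cycle_free E W m"
  by (auto simp: cycle_free_def)

lemma dcyc_card: "dcyc E c m \<Longrightarrow> card (c ` {..<m}) = m"
  by (simp add: dcyc_def card_image)

lemma add_mod_inj_on: "inj_on (\<lambda>j. (i + j) mod m) {..<m::nat}"
proof (rule linorder_inj_onI')
  fix x y assume xy: "x \<in> {..<m}" "y \<in> {..<m}" "x < y"
  show "(i + x) mod m \<noteq> (i + y) mod m"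
  proof
    assume "(i + x) mod m = (i + y) mod m"
    then have "m dvd (i + y) - (i + x)" using xy by (metis mod_eq_dvd_iff_nat add_left_mono less_imp_le)
    then have "m dvd y - x" by simp
    then show False using xy by (auto dest!: dvd_imp_le)
  qed
qed

lemma dcyc_rotate:
  assumes "dcyc E c m"
  shows "dcyc E (\<lambda>j. c ((i + j) mod m)) m"
    and "(\<lambda>j. c ((i + j) mod m)) ` {..<m} = c ` {..<m}"
proof -
  have im: "(\<lambda>j. (i + j) mod m) ` {..<m} = {..<m}"
    by (rule endo_inj_surj) (auto simp: add_mod_inj_on)
  have inj: "inj_on (c \<circ> (\<lambda>j. (i + j) mod m)) {..<m}"
    using assms by (intro comp_inj_on add_mod_inj_on) (simp add: im dcyc_def)
  have "(i + Suc j mod m) mod m = Suc ((i + j) mod m) mod m" for j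
    by (simp add: mod_simps)
  then show "dcyc E (\<lambda>j. c ((i + j) mod m)) m"
    using assms inj by (auto simp: dcyc_def o_def)
  show "(\<lambda>j. c ((i + j) mod m)) ` {..<m} = c ` {..<m}"
    using im by (metis image_image)
qed

text \<open>Rotating the cycle so that \<open>c i\<close> comes last reduces the insertion of
  \<open>u\<close> to appending it; only the two arcs at the wrap-around are new.\<close>

lemma dcyc_insert:
  assumes c: "dcyc E c m" and u: "u \<notin> c ` {..<m}" and i: "i < m"
    and E: "E (c i) u" "E u (c (Suc i mod m))"
  shows "\<exists>c'. dcyc E c' (Suc m) \<and> c' ` {..<Suc m} = insert u (c ` {..<m})"
proof -
  define b where "b j = c ((Suc i + j) mod m)" for j
  define c' where "c' = b(m := u)"
  have b: "dcyc E b m" "b ` {..<m} = c ` {..<m}"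
    unfolding b_def by (rule dcyc_rotate[OF c])+
  have eq: "c' ` {..<m} = b ` {..<m}" unfolding c'_def by (intro image_cong) auto
  have m: "c' m = u" by (simp add: c'_def)
  have im: "c' ` {..<Suc m} = insert u (c ` {..<m})"
    by (simp only: lessThan_Suc image_insert eq b(2) m)
  have "inj_on c' {..<m} \<longleftrightarrow> inj_on b {..<m}" by (rule inj_on_cong) (simp add: c'_def)
  then have "inj_on c' {..<m}" using b(1) by (simp add: dcyc_def)
  then have inj: "inj_on c' {..<Suc m}"
    unfolding lessThan_Suc using m eq b(2) u by simp
  have "E (c' j) (c' (Suc j mod Suc m))" if j: "j < Suc m" for j
  proof -
    consider "j = m" | "Suc j = m" | "Suc j < m" using j by linarith
    then show ?thesis
    proof cases
      case 1
      then have "c' (Suc j mod Suc m) = c (Suc i mod m)" using i by (simp add: c'_def b_def)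
      then show ?thesis using E(2) m 1 by simp
    next
      case 2
      then have "Suc i + j = i + m" by simp
      then have "b j = c i" unfolding b_def using i by (metis mod_add_self2 mod_less)
      then have "c' j = c i" using 2 by (auto simp: c'_def)
      moreover have "c' (Suc j mod Suc m) = u" using 2 by (simp add: c'_def)
      ultimately show ?thesis using E(1) by simp
    next
      case 3
      then have "E (b j) (b (Suc j mod m))" using b(1) unfolding dcyc_def
        by (metis One_nat_def Suc_lessD less_Suc0 nat.distinct(1))
      then show ?thesis using 3 by (simp add: c'_def)
    qed
  qed
  then have "dcyc E c' (Suc m)" using inj by (simp add: dcyc_def)
  then show ?thesis using im by blast
qed

text \<open>Measured from \<open>card C\<close>, the largest possible number of arcs between
  \<open>u\<close> and a cycle \<open>C\<close> that cannot be extended by \<open>u\<close>.\<close>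

definition deficit :: "('a \<Rightarrow> 'a \<Rightarrow> bool) \<Rightarrow> 'a set \<Rightarrow> 'a \<Rightarrow> int" where
  "deficit E C u = int (card C) - cnt E C {u} - cnt E {u} C"

text \<open>Pair the possible arc from \<open>c j\<close> to \<open>u\<close> with the one from
  \<open>u\<close> to the cyclic successor of \<open>c j\<close>. Both together would insert
  \<open>u\<close> into the cycle, so each of the \<open>m\<close> pairs supplies at most one
  arc.\<close>

lemma deficit_nonneg:
  assumes c: "dcyc E c m" and C: "C = c ` {..<m}" and u: "u \<notin> C"
    and free: "cycle_free E (insert u C) (Suc m)"
  shows "0 \<le> deficit E C u"
proof (cases "m = 0")
  case True
  then show ?thesis using C by (simp add: deficit_def)
next
  case False
  have inj: "inj_on c {..<m}" using c by (simp add: dcyc_def)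
  have rot: "inj_on (\<lambda>j. Suc j mod m) {..<m}" using add_mod_inj_on[of 1 m] by simp
  have im: "(\<lambda>j. Suc j mod m) ` {..<m} = {..<m}"
    by (rule endo_inj_surj) (use rot False in auto)
  have bij: "bij_betw (\<lambda>j. Suc j mod m) {..<m} {..<m}" using rot im by (simp add: bij_betw_def)
  have "cnt E {u} C = (\<Sum>j<m. of_bool (E u (c j)))"
    unfolding cnt_def C by (simp add: sum.reindex[OF inj])
  also have "\<dots> = (\<Sum>j<m. of_bool (E u (c (Suc j mod m))))"
    by (rule sum.reindex_bij_betw[OF bij, symmetric])
  finally have 1: "cnt E {u} C = (\<Sum>j<m. of_bool (E u (c (Suc j mod m))))" .
  have 2: "cnt E C {u} = (\<Sum>j<m. of_bool (E (c j) u))"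
    unfolding cnt_def C by (simp add: sum.reindex[OF inj])
  have "\<not> (E (c j) u \<and> E u (c (Suc j mod m)))" if "j < m" for j
    using dcyc_insert[OF c _ that, of u] u free unfolding C cycle_free_def by (metis order_refl)
  then have "cnt E C {u} + cnt E {u} C \<le> (\<Sum>j<m. 1)"
    unfolding 1 2 sum.distrib[symmetric] by (intro sum_mono) auto
  then show ?thesis using dcyc_card[OF c] by (simp add: deficit_def C)
qed

text \<open>Single vertices make the set of admissible lengths nonempty, so it has a maximum. The
  last conclusion reaches up to \<open>Suc k\<close>, hence it excludes cycles of length
  \<open>Suc l\<close> even for \<open>l = k\<close>.\<close>

lemma max_cycle_exists:
  assumes "finite V" "V \<noteq> {}" "cycle_free E V (Suc k)" "1 \<le> k"
  obtains c l where "1 \<le> l" "l \<le> k" "dcyc E c l" "c ` {..<l} \<subseteq> V"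
    "\<And>j. \<lbrakk>l < j; j \<le> Suc k\<rbrakk> \<Longrightarrow> cycle_free E V j"
proof -
  define L where "L = {l. 1 \<le> l \<and> l \<le> k \<and> \<not> cycle_free E V l}"
  obtain v where "v \<in> V" using assms by auto
  then have "dcyc E (\<lambda>_. v) 1 \<and> (\<lambda>_. v) ` {..<1::nat} \<subseteq> V"
    by (simp add: dcyc_def lessThan_Suc)
  then have 1: "1 \<in> L" unfolding L_def cycle_free_def using assms(4) by blast
  have fin: "finite L" unfolding L_def by simp
  have "Max L \<in> L" using fin 1 by (intro Max_in) auto
  then obtain c where "1 \<le> Max L" "Max L \<le> k" "dcyc E c (Max L)" "c ` {..<Max L} \<subseteq> V"
    by (auto simp: L_def cycle_free_def)
  moreover have "cycle_free E V j" if "Max L < j" "j \<le> Suc k" for j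
  proof (rule ccontr)
    assume n: "\<not> cycle_free E V j"
    then have "j \<le> k" using that assms(3) by (metis le_SucE)
    then have "j \<in> L" using n that by (auto simp: L_def)
    then show False using Max_ge[OF fin] that by fastforce
  qed
  ultimately show ?thesis by (rule that)
qed

section \<open>The maximal number of arcs\<close>

text \<open>Listing the vertices of the extremal digraph block by block from index \<open>0\<close>, with the incomplete
  block last, the vertex \<open>i\<close> adds \<open>i + i mod k\<close> arcs to those among its predecessors.\<close>

definition max_arcs :: "nat \<Rightarrow> nat \<Rightarrow> int" where
  "max_arcs k n = (\<Sum>i<n. int i + int (i mod k))"

definition gap :: "nat \<Rightarrow> ('a \<Rightarrow> 'a \<Rightarrow> bool) \<Rightarrow> 'a set \<Rightarrow> int" where
  "gap k E V = max_arcs k (card V) - cnt E V V"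

text \<open>Doubled to avoid halves: \<open>n * (n - 1)\<close> stands for one arc per pair of
  vertices, the other terms for the second arcs inside the blocks. The case \<open>r = k\<close> is
  included so that a full block can also be read as the remainder.\<close>

lemma max_arcs_twice:
  assumes "r \<le> k"
  shows "2 * max_arcs k (q * k + r) =
    int (q * k + r) * (int (q * k + r) - 1) + int q * int k * (int k - 1) + int r * (int r - 1)"
proof -
  have step: "2 * max_arcs k (q * k + r) =
    2 * max_arcs k (q * k) + 2 * int q * int k * int r + 2 * int r * (int r - 1)" if "r \<le> k" for q r
    using that
  proof (induction r)
    case (Suc r)
    then have "(q * k + r) mod k = r" by simp
    then show ?case using Suc by (simp add: max_arcs_def algebra_simps)
  qed simp
  have "2 * max_arcs k (q * k) = int (q * k) * (int (q * k) - 1) + int q * int k * (int k - 1)"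
  proof (induction q)
    case 0
    then show ?case by (simp add: max_arcs_def)
  next
    case (Suc q)
    have "2 * max_arcs k (Suc q * k) = 2 * max_arcs k (q * k + k)" by (simp add: add.commute)
    also have "\<dots> = 2 * max_arcs k (q * k) + 2 * int q * int k * int k + 2 * int k * (int k - 1)"
      using step[of k q] by simp
    finally show ?case using Suc by (simp add: algebra_simps)
  qed
  then show ?thesis using step[OF assms, of q] by (simp add: algebra_simps)
qed

text \<open>The loss forced by splitting off \<open>l\<close> vertices: even if these are complete,
  every other vertex has \<open>l\<close> arcs to and from them and the rest is extremal, the number
  of arcs stays this far below \<open>max_arcs k n\<close>.\<close>

definition gain :: "nat \<Rightarrow> nat \<Rightarrow> nat \<Rightarrow> int" where
  "gain k n l = max_arcs k n - max_arcs k (n - l) - int l * int (n - l) - int l * (int l - 1)"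

text \<open>Only the last block shrinks, to \<open>r - l\<close> vertices. Nothing is lost for
  \<open>l = r\<close>, when exactly this block is removed.\<close>

lemma gain_le:
  assumes "l \<le> r" "r \<le> k"
  shows "gain k (q * k + r) l = int l * (int r - int l)"
proof -
  have n: "q * k + r - l = q * k + (r - l)" using assms by simp
  have i: "int (r - l) = int r - int l" using assms by simp
  have "2 * gain k (q * k + r) l = 2 * max_arcs k (q * k + r) - 2 * max_arcs k (q * k + (r - l))
    - 2 * int l * int (q * k + (r - l)) - 2 * int l * (int l - 1)"
    by (simp add: gain_def n)
  also have "\<dots> = 2 * (int l * (int r - int l))"
    using assms by (simp only: max_arcs_twice diff_le_self le_trans[OF diff_le_self] of_nat_add of_nat_mult i)
      (simp add: algebra_simps)
  finally show ?thesis by simp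
qed

text \<open>The last block is too small, so a full block is broken up and the new remainder is
  \<open>k + r - l\<close>. Nothing is lost exactly for \<open>l = k\<close>.\<close>

lemma gain_gt:
  assumes "r < l" "l \<le> k" "l \<le> q * k + r"
  shows "gain k (q * k + r) l = (int k - int l) * (int l - int r)"
proof -
  from assms obtain p where q: "q = Suc p" by (cases q) auto
  have n: "q * k + r - l = p * k + (k + r - l)" using assms by (simp add: q)
  have i: "int (k + r - l) = int k + int r - int l" "k + r - l \<le> k" "r \<le> k" using assms by simp_all
  have "2 * gain k (q * k + r) l = 2 * max_arcs k (q * k + r) - 2 * max_arcs k (p * k + (k + r - l))
    - 2 * int l * int (p * k + (k + r - l)) - 2 * int l * (int l - 1)"
    by (simp add: gain_def n)
  also have "\<dots> = 2 * ((int k - int l) * (int l - int r))"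
    by (simp only: max_arcs_twice i of_nat_add of_nat_mult q of_nat_Suc)
      (simp add: algebra_simps)
  finally show ?thesis by simp
qed

text \<open>The arcs inside \<open>C\<close>, between \<open>C\<close> and the rest, and inside the
  rest are each compared with their ideal number. As this is an identity, small or zero gaps can
  later be analysed term by term.\<close>

lemma gap_remove:
  assumes "finite V" "C \<subseteq> V"
  shows "gap k E V = gain k (card V) (card C) + defect E C + (\<Sum>u\<in>V - C. deficit E C u)
    + gap k E (V - C)"
proof -
  have fin: "finite C" "card C \<le> card V" "card (V - C) = card V - card C"
    using assms by (auto intro: finite_subset card_mono simp: card_Diff_subset finite_subset)
  have "(\<Sum>u\<in>V - C. deficit E C u)
      = int (card C) * int (card (V - C)) - cnt E C (V - C) - cnt E (V - C) C"
    using cnt_sum_right[of E C "V - C"] cnt_sum_left[of E "V - C" C]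
    by (simp add: deficit_def sum_subtractf)
  then show ?thesis
    using cnt_split[OF assms, of E] fin
    by (simp add: gap_def gain_def defect_def algebra_simps)
qed

text \<open>The remainder is taken from 1 to \<open>k\<close>, so that a multiple of
  \<open>k\<close> ends in a full block and the last block is never empty.\<close>

lemma card_eq_residue:
  assumes "1 \<le> (k::nat)" "1 \<le> n"
  obtains q r where "n = q * k + r" "1 \<le> r" "r \<le> k"
proof
  show "n = ((n - 1) div k) * k + Suc ((n - 1) mod k)"
    using assms div_mult_mod_eq[of "n - 1" k] by linarith
  show "1 \<le> Suc ((n - 1) mod k)" by simp
  show "Suc ((n - 1) mod k) \<le> k" using assms by (simp add: Suc_leI)
qed

lemma gain_nonneg:
  assumes "1 \<le> l" "l \<le> k" "l \<le> n"
  shows "0 \<le> gain k n l"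
proof -
  obtain q r where n: "n = q * k + r" "1 \<le> r" "r \<le> k"
    using card_eq_residue[of k n] assms by auto
  show ?thesis
  proof (cases "l \<le> r")
    case True
    then show ?thesis using gain_le[of l r k q] n by simp
  next
    case False
    then show ?thesis using gain_gt[of r l k q] n assms by simp
  qed
qed

text \<open>For a cycle that is longest among those of length at most \<open>k\<close>, no cycle of
  length \<open>Suc l\<close> exists. This makes every term of \<open>gap_remove\<close>
  nonnegative, the last one by induction.\<close>

theorem gap_nonneg:
  assumes "finite V" "1 \<le> k" "\<And>x. \<not> E x x" "cycle_free E V (Suc k)"
  shows "0 \<le> gap k E V"
  using assms(1,4)
proof (induction "card V" arbitrary: V rule: less_induct)
  case less
  show ?case
  proof (cases "V = {}")
    case True
    then show ?thesis by (simp add: gap_def max_arcs_def)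
  next
    case False
    obtain c l where l: "1 \<le> l" "l \<le> k" and c: "dcyc E c l" "c ` {..<l} \<subseteq> V"
      and free: "\<And>j. \<lbrakk>l < j; j \<le> Suc k\<rbrakk> \<Longrightarrow> cycle_free E V j"
      using max_cycle_exists[OF less.prems(1) False less.prems(2) assms(2)] by metis
    define C where "C = c ` {..<l}"
    have C: "C \<subseteq> V" "card C = l" "finite C" "l \<le> card V"
      using c dcyc_card[OF c(1)] card_mono[OF less.prems(1) c(2)] by (auto simp: C_def)
    have "0 \<le> (\<Sum>u\<in>V - C. deficit E C u)"
      by (intro sum_nonneg deficit_nonneg[OF c(1) C_def] cycle_free_subset[OF free[of "Suc l"]])
        (use l C in auto)
    moreover have "0 \<le> gap k E (V - C)"
      using C l less.prems by (intro less.hyps cycle_free_subset[OF less.prems(2)])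
        (auto simp: card_Diff_subset)
    moreover have "0 \<le> gain k (card V) l" using gain_nonneg l C by auto
    moreover have "0 \<le> defect E C" using defect_nonneg[OF C(3)] assms(3) by metis
    ultimately show ?thesis using gap_remove[OF less.prems(1) C(1), of k E] C by simp
  qed
qed

section \<open>Nearly complete cycles\<close>

definition is_cycle :: "('a \<Rightarrow> 'a \<Rightarrow> bool) \<Rightarrow> 'a set \<Rightarrow> nat \<Rightarrow> bool" where
  "is_cycle E C l \<longleftrightarrow> (\<exists>c. dcyc E c l \<and> C = c ` {..<l})"

text \<open>The merged vertex keeps the name \<open>p\<close>: it sends the arcs leaving
  \<open>s\<close> and receives those entering \<open>p\<close>. The vertex \<open>s\<close> is
  meant to be dropped from the vertex set.\<close>

definition contract :: "('a \<Rightarrow> 'a \<Rightarrow> bool) \<Rightarrow> 'a \<Rightarrow> 'a \<Rightarrow> 'a \<Rightarrow> 'a \<Rightarrow> bool" where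
  "contract E s p x y \<longleftrightarrow> x \<noteq> y \<and> (if x = p then E s y else E x y)"

text \<open>Contracting \<open>s\<close> and \<open>p\<close> to a single vertex turns a Hamiltonian path from \<open>s\<close> to \<open>p\<close> into a
  Hamiltonian cycle, and the latter exists because \<open>(l - 2)\<^sup>2\<close> is the maximal number of arcs of
  a non-Hamiltonian digraph on \<open>l - 1\<close> vertices.\<close>

lemma almost_complete_hamiltonian_path:
  assumes irr: "\<And>x. \<not> E x x" and fin: "finite C" and l: "card C = l" "3 \<le> l"
    and d: "defect E C \<le> int l - 3"
    and p: "p \<in> C" "s \<in> C" "p \<noteq> s"
  obtains c where "dcyc (contract E s p) c (l - 1)"
    "c ` {..<l - 1} = C - {s}"
proof -
  define F where "F = contract E s p"
  define D where "D = C - {s, p}"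
  have D: "finite D" "p \<notin> D" "s \<notin> D" "C = insert s (insert p D)" "C - {s} = insert p D"
    "card D = l - 2"
    using fin p l by (auto simp: D_def card_Diff_subset)
  have cD: "card (insert p D) = l - 1" using D l by simp
  have irrF: "\<not> F x x" for x by (simp add: F_def contract_def)
  have E1: "cnt E C C = cnt E {s} D + cnt E {s} {p} + cnt E {p} C + cnt E D D + cnt E D {p} + cnt E D {s}"
  proof -
    have f: "finite (insert p D)" "s \<notin> insert p D" "finite D" "p \<notin> D" using D p by auto
    have right: "cnt E A C = cnt E A {s} + (cnt E A {p} + cnt E A D)" for A
      unfolding D(4) using cnt_insert_right[OF f(1,2)] cnt_insert_right[OF f(3,4)] by metis
    have left: "cnt E C A = cnt E {s} A + (cnt E {p} A + cnt E D A)" for A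
      unfolding D(4) using cnt_insert_left[OF f(1,2)] cnt_insert_left[OF f(3,4)] by metis
    have "cnt E {s} {s} = 0" using irr by (simp add: cnt_def)
    then show ?thesis using left[of C] right[of "{s}"] right[of D] by simp
  qed
  have F1: "cnt F (insert p D) (insert p D) = cnt E {s} D + cnt E D D + cnt E D {p}"
  proof -
    have "cnt F (insert p D) (insert p D) = cnt F {p} (insert p D) + cnt F D (insert p D)"
      using cnt_insert_left D(1,2) by metis
    also have "\<dots> = cnt F {p} {p} + cnt F {p} D + (cnt F D {p} + cnt F D D)"
      using cnt_insert_right[OF D(1,2), of F] by metis
    also have "cnt F {p} {p} = 0" by (simp add: cnt_def F_def contract_def)
    also have "cnt F {p} D = cnt E {s} D"
      unfolding cnt_def using D(2) by (auto simp: F_def contract_def intro!: sum.cong)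
    also have "cnt F D {p} = cnt E D {p}"
      unfolding cnt_def using D(2) by (auto simp: F_def contract_def intro!: sum.cong)
    also have "cnt F D D = cnt E D D"
      unfolding cnt_def using D(2) irr by (intro sum.cong) (auto simp: F_def contract_def)
    finally show ?thesis by simp
  qed
  \<comment> \<open>The contraction forgets at most \<open>2 * l - 2\<close> arcs: the one from
    \<open>s\<close> to \<open>p\<close>, those leaving \<open>p\<close>, and those from
    \<open>D\<close> to \<open>s\<close>.\<close>
  have "cnt E {s} {p} \<le> 1" using cnt_le_card[of E "{s}" "{p}"] by simp
  moreover have "cnt E {p} C \<le> int l - 1"
  proof -
    have "cnt E {p} C = cnt E {p} ({p} \<union> (C - {p}))" using p by (simp add: insert_absorb)
    also have "\<dots> = cnt E {p} (C - {p})"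
      using fin irr by (subst cnt_union_right) (auto simp: cnt_def)
    also have "\<dots> \<le> int (card (C - {p}))" using cnt_le_card[of E "{p}" "C - {p}"] by simp
    finally show ?thesis using p l fin by (simp add: of_nat_diff)
  qed
  moreover have "cnt E D {s} \<le> int l - 2" using cnt_le_card[of E D "{s}"] D l by simp
  ultimately have "cnt E C C \<le> cnt F (insert p D) (insert p D) + 2 * int l - 2"
    using E1 F1 by simp
  then have big: "cnt F (insert p D) (insert p D) \<ge> int l * (int l - 1) - (int l - 3) - 2 * int l + 2"
    using d l by (simp add: defect_def)
  have "\<not> cycle_free F (insert p D) (l - 1)"
  proof
    assume "cycle_free F (insert p D) (l - 1)"
    \<comment> \<open>A Hamiltonian cycle on \<open>l - 1\<close> vertices has length
      \<open>Suc (l - 2)\<close>, so its absence is the hypothesis of the arc bound with block size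
      \<open>l - 2\<close>: one full block and a single further vertex.\<close>
    then have "0 \<le> gap (l - 2) F (insert p D)"
      using D irrF l by (intro gap_nonneg) (auto simp: Suc_diff_Suc numeral_2_eq_2 eval_nat_numeral)
    moreover have "2 * max_arcs (l - 2) (l - 1) = 2 * (int l - 2) ^ 2"
    proof -
      have "l - 1 = 1 * (l - 2) + 1" "1 \<le> l - 2" using l by auto
      then have "2 * max_arcs (l - 2) (l - 1) = (int l - 1) * (int l - 2) + (int l - 2) * (int l - 3)"
        using max_arcs_twice[of 1 "l - 2" 1] l by (simp add: of_nat_diff)
      then show ?thesis by (simp add: power2_eq_square algebra_simps)
    qed
    ultimately have "cnt F (insert p D) (insert p D) \<le> (int l - 2) ^ 2"
      using cD by (simp add: gap_def)
    \<comment> \<open>The lower bound in \<open>big\<close> equals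
      \<open>(l - 2)^2 + 1\<close>.\<close>
    then show False using big by (simp add: power2_eq_square algebra_simps)
  qed
  then obtain c where c: "dcyc F c (l - 1)" "c ` {..<l - 1} \<subseteq> insert p D"
    by (auto simp: cycle_free_def)
  have "c ` {..<l - 1} = insert p D"
    using c D(1) cD dcyc_card[OF c(1)] by (intro card_subset_eq) auto
  then show ?thesis using that c(1) D(5) unfolding F_def by auto
qed

text \<open>If \<open>p\<close> and \<open>s\<close> differ, a Hamiltonian path of \<open>C\<close>
  from \<open>s\<close> to \<open>p\<close>, closed through \<open>u\<close>, is a forbidden cycle
  of length \<open>Suc l\<close>.\<close>

lemma almost_complete_no_bypass:
  assumes irr: "\<And>x. \<not> E x x" and fin: "finite C" and l: "card C = l" "3 \<le> l"
    and d: "defect E C \<le> int l - 3"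
    and free: "cycle_free E (insert u C) (Suc l)" and u: "u \<notin> C"
    and p: "p \<in> C" "s \<in> C" "E p u" "E u s"
  shows "p = s"
proof (rule ccontr)
  assume ps: "p \<noteq> s"
  define F where "F = contract E s p"
  obtain c where c: "dcyc F c (l - 1)" "c ` {..<l - 1} = C - {s}"
    unfolding F_def by (rule almost_complete_hamiltonian_path[OF irr fin l d p(1,2) ps])
  define m where "m = l - 2"
  have m: "l - 1 = Suc m" "l = Suc (Suc m)" "1 \<le> m" using l by (auto simp: m_def)
  have "p \<in> c ` {..<Suc m}" using c(2) p ps m by auto
  then obtain i where i: "i < Suc m" "c i = p" by auto
  \<comment> \<open>Rotated so that the merged vertex \<open>p\<close> comes last; its outgoing arc
    to \<open>b 0\<close> then stands for an arc from \<open>s\<close>.\<close>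
  define b where "b j = c ((Suc i + j) mod Suc m)" for j
  have b: "dcyc F b (Suc m)" "b ` {..<Suc m} = C - {s}"
    using dcyc_rotate[OF c(1), of "Suc i"] c(2) unfolding b_def m(1) by simp_all
  have bm: "b m = p"
  proof -
    have "Suc i + m = i + Suc m" by simp
    then have "(Suc i + m) mod Suc m = i" using i by (metis mod_add_self2 mod_less)
    then show ?thesis using i by (simp add: b_def)
  qed
  have Fb: "F (b j) (b (Suc j mod Suc m))" if "j < Suc m" for j
    using b(1) that m unfolding dcyc_def by auto
  have inj: "inj_on b {..<Suc m}" using b(1) by (simp add: dcyc_def)
  have bE: "E (b j) (b (Suc j))" if "j < m" for j
  proof -
    have "b j \<noteq> p" using inj that bm by (metis inj_onD lessThan_iff less_Suc_eq nat_neq_iff)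
    then show ?thesis using Fb[of j] that by (simp add: F_def contract_def)
  qed
  have b0: "E s (b 0)" using Fb[of m] bm by (simp add: F_def contract_def)
  \<comment> \<open>The long cycle: first \<open>u\<close>, then \<open>s\<close>, then the path
    \<open>b\<close>, which reaches \<open>p\<close> at index \<open>l\<close>.\<close>
  define a where "a j = (case j of 0 \<Rightarrow> u | Suc 0 \<Rightarrow> s | Suc (Suc i) \<Rightarrow> b i)" for j
  have a: "a 0 = u" "a (Suc 0) = s" "a (Suc (Suc i)) = b i" for i by (auto simp: a_def)
  have split: "{..<Suc l} = insert 0 (insert (Suc 0) ((\<lambda>j. Suc (Suc j)) ` {..<Suc m}))"
    unfolding m(2) by (auto simp: image_iff less_Suc_eq_0_disj)
  have im: "a ` {..<Suc l} = insert u C"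
    unfolding split using b(2) p by (auto simp: a image_image)
  have "card (insert u C) = Suc l" using u fin l by simp
  then have "inj_on a {..<Suc l}" using im by (intro eq_card_imp_inj_on) auto
  moreover have "E (a j) (a (Suc j mod Suc l))" if j: "j < Suc l" for j
  proof -
    consider "j = 0" | "j = 1" | "j = l" | i where "j = Suc (Suc i)" "i < m"
    proof atomize_elim
      have "j = 0 \<or> j = 1 \<or> j = l \<or> j = Suc (Suc (j - 2)) \<and> j - 2 < m" using j m by linarith
      then show "j = 0 \<or> j = 1 \<or> j = l \<or> (\<exists>i. j = Suc (Suc i) \<and> i < m)" by blast
    qed
    then show ?thesis
    proof cases
      case 1 then show ?thesis using p l by (simp add: a)
    next
      case 2 then show ?thesis using b0 m by (simp add: a)
    next
      case 3 then show ?thesis using bm p m by (simp add: a)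
    next
      case 4 then show ?thesis using bE m by (simp add: a)
    qed
  qed
  ultimately have "dcyc E a (Suc l)" by (simp add: dcyc_def)
  then show False using free im unfolding cycle_free_def by blast
qed

text \<open>If all arcs between \<open>u\<close> and \<open>C\<close> have the same direction, every
  neighbour accounts for one arc and the deficit counts the nonneighbours. Otherwise
  \<open>almost_complete_no_bypass\<close> merges all in- and out-neighbours of \<open>u\<close> in
  \<open>C\<close> into one vertex, joined to \<open>u\<close> in both directions.\<close>

lemma deficit_almost_complete:
  assumes irr: "\<And>x. \<not> E x x" and fin: "finite C" and l: "card C = l" "3 \<le> l"
    and d: "defect E C \<le> int l - 3"
    and free: "cycle_free E (insert u C) (Suc l)" and u: "u \<notin> C"
  shows "deficit E C u = cnt (nonadj E) {u} C \<or>
    deficit E C u = int l - 2 \<and> cnt (nonadj E) {u} C = int l - 1"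
proof -
  have eq: "(\<Sum>y\<in>C. of_bool (E u y \<or> E y u)) + cnt (nonadj E) {u} C = int l"
  proof -
    have pointwise: "of_bool (E u y \<or> E y u) + of_bool (nonadj E u y) = (1::int)" if "y \<in> C" for y
      using that u by (auto simp: nonadj_def)
    have "cnt (nonadj E) {u} C = (\<Sum>y\<in>C. of_bool (nonadj E u y))" by (simp add: cnt_def)
    then have "(\<Sum>y\<in>C. of_bool (E u y \<or> E y u)) + cnt (nonadj E) {u} C
        = (\<Sum>y\<in>C. of_bool (E u y \<or> E y u) + of_bool (nonadj E u y))"
      by (simp only: sum.distrib)
    also have "\<dots> = (\<Sum>y\<in>C. 1)" by (rule sum.cong[OF refl pointwise])
    finally show ?thesis using l by simp
  qed
  have def_eq: "deficit E C u = int l - (\<Sum>y\<in>C. of_bool (E y u) + of_bool (E u y))"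
    by (simp add: deficit_def cnt_def l sum.distrib)
  show ?thesis
  proof (cases "\<exists>p\<in>C. \<exists>s\<in>C. E p u \<and> E u s")
    case False
    then have "(\<Sum>y\<in>C. of_bool (E y u) + of_bool (E u y)) = (\<Sum>y\<in>C. (of_bool (E u y \<or> E y u) :: int))"
      by (intro sum.cong) auto
    then show ?thesis using eq def_eq by simp
  next
    case True
    then obtain p s where p: "p \<in> C" "s \<in> C" "E p u" "E u s" by auto
    note nb = almost_complete_no_bypass[OF irr fin l d free u]
    have ps: "p = s" using nb[OF p] .
    have 1: "E y u \<longleftrightarrow> y = p" if "y \<in> C" for y using nb[OF that p(2) _ p(4)] p ps by auto
    have 2: "E u y \<longleftrightarrow> y = p" if "y \<in> C" for y using nb[OF p(1) that p(3)] p ps by auto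
    have "(\<Sum>y\<in>C. of_bool (E y u) + of_bool (E u y)) = (\<Sum>y\<in>C. (2 * of_bool (y = p) :: int))"
      using 1 2 by (intro sum.cong) auto
    also have "\<dots> = 2" using p(1) fin by (simp add: of_bool_def sum.delta flip: sum_distrib_left)
    finally have 3: "deficit E C u = int l - 2" using def_eq by simp
    have "(\<Sum>y\<in>C. of_bool (E u y \<or> E y u)) = (\<Sum>y\<in>C. (of_bool (y = p) :: int))"
      using 1 2 by (intro sum.cong) auto
    also have "\<dots> = 1" using p(1) fin by (simp add: of_bool_def sum.delta flip: sum_distrib_left)
    finally show ?thesis using eq 3 by simp
  qed
qed

section \<open>Nonadjacent pairs in nearly extremal digraphs\<close>

lemma mult_ge_sum_minus_1:
  fixes a b :: int
  assumes "1 \<le> a" "1 \<le> b"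
  shows "a + b - 1 \<le> a * b"
proof -
  have "0 \<le> (a - 1) * (b - 1)" using assms by simp
  then show ?thesis by (simp add: algebra_simps)
qed

text \<open>Combines \<open>gap_remove\<close> with the signs of all its terms, so that each single
  term is bounded by the gap through linear arithmetic.\<close>

lemma remove_cycle:
  assumes irr: "\<And>x. \<not> E x x" and fin: "finite V" and k: "1 \<le> k"
    and free: "cycle_free E V (Suc k)"
    and C: "is_cycle E C l" "C \<subseteq> V" and l: "1 \<le> l" "l \<le> k" and freel: "cycle_free E V (Suc l)"
  shows "gap k E V = gain k (card V) l + defect E C + (\<Sum>u\<in>V - C. deficit E C u) + gap k E (V - C)"
    and "card C = l" "finite C" "card (V - C) = card V - l" "l \<le> card V"
    and "0 \<le> gain k (card V) l" "0 \<le> defect E C"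
    and "\<And>u. u \<in> V - C \<Longrightarrow> 0 \<le> deficit E C u"
    and "0 \<le> (\<Sum>u\<in>V - C. deficit E C u)"
    and "0 \<le> gap k E (V - C)" "cycle_free E (V - C) (Suc k)"
proof -
  obtain c where c: "dcyc E c l" "C = c ` {..<l}" using C by (auto simp: is_cycle_def)
  show 1: "card C = l" using dcyc_card[OF c(1)] c by simp
  show 2: "finite C" using fin C finite_subset by blast
  show 3: "l \<le> card V" using 1 card_mono[OF fin C(2)] by simp
  show "card (V - C) = card V - l" using 1 2 C by (simp add: card_Diff_subset)
  show "gap k E V = gain k (card V) l + defect E C + (\<Sum>u\<in>V - C. deficit E C u) + gap k E (V - C)"
    using gap_remove[OF fin C(2)] 1 by simp
  show "0 \<le> gain k (card V) l" using gain_nonneg l 3 by simp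
  show "0 \<le> defect E C" using defect_nonneg[of C E] 2 irr by simp
  show 4: "0 \<le> deficit E C u" if "u \<in> V - C" for u
    using that C by (intro deficit_nonneg[OF c] cycle_free_subset[OF freel]) auto
  show "0 \<le> (\<Sum>u\<in>V - C. deficit E C u)" using 4 by (intro sum_nonneg)
  show 5: "cycle_free E (V - C) (Suc k)" by (rule cycle_free_subset[OF free]) auto
  show "0 \<le> gap k E (V - C)" using fin by (intro gap_nonneg[OF _ k irr 5]) auto
qed

lemma longest_short_cycle:
  assumes "finite V" "V \<noteq> {}" "cycle_free E V (Suc k)" "1 \<le> k"
  obtains C l where "1 \<le> l" "l \<le> k" "is_cycle E C l" "C \<subseteq> V"
    "\<And>j. \<lbrakk>l < j; j \<le> Suc k\<rbrakk> \<Longrightarrow> cycle_free E V j"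
  using max_cycle_exists[OF assms] unfolding is_cycle_def by metis

lemma is_cycle_not_free: "\<lbrakk>is_cycle E C l; C \<subseteq> V\<rbrakk> \<Longrightarrow> \<not> cycle_free E V l"
  by (auto simp: is_cycle_def cycle_free_def)

text \<open>A longest short cycle has \<open>1 \<le> l < k\<close>. With the multiple of
  \<open>k\<close> read as having remainder \<open>k\<close>, its gain is
  \<open>l * (k - l)\<close>, which is at least \<open>k - 1\<close>.\<close>

lemma gap_without_k_cycle:
  assumes irr: "\<And>x. \<not> E x x" and fin: "finite V" and k: "1 \<le> k"
    and free: "cycle_free E V (Suc k)" "cycle_free E V k" and card: "card V = q * k" "1 \<le> q"
  shows "int k - 1 \<le> gap k E V"
proof -
  have "V \<noteq> {}" using card k by auto
  then obtain C l where l: "1 \<le> l" "l \<le> k" and C: "is_cycle E C l" "C \<subseteq> V"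
    and lfree: "\<And>j. \<lbrakk>l < j; j \<le> Suc k\<rbrakk> \<Longrightarrow> cycle_free E V j"
    using longest_short_cycle[OF fin _ free(1) k] by metis
  have freel: "cycle_free E V (Suc l)" using lfree l by simp
  note rc = remove_cycle[OF irr fin k free(1) C l freel]
  have lk: "l < k" using is_cycle_not_free[OF C] free(2) l by (metis le_neq_implies_less)
  have "card V = (q - 1) * k + k" using card by (cases q) auto
  then have "gain k (card V) l = int l * (int k - int l)" using gain_le[of l k k "q - 1"] l by simp
  then have "int k - 1 \<le> gain k (card V) l"
    using mult_ge_sum_minus_1[of "int l" "int k - int l"] l lk by simp
  then show ?thesis using rc(1,7,9,10) by linarith
qed

text \<open>Every term of the gap vanishes, so \<open>C\<close> is complete and its length is the
  remainder or \<open>k\<close>. A remainder below \<open>k\<close> with vertices left over would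
  leave a multiple of \<open>k\<close> vertices without a \<open>k\<close>-cycle, which costs at
  least \<open>k - 1\<close>. For \<open>l = k\<close> zero deficits exclude the exceptional case
  \<open>l - 2\<close> and hence nonneighbours.\<close>

lemma nonadj_eq_0_of_gap_eq_0:
  assumes irr: "\<And>x. \<not> E x x" and fin: "finite V" and k: "3 \<le> k"
    and free: "cycle_free E V (Suc k)" and gap: "gap k E V = 0"
  shows "cnt (nonadj E) V V = 0"
  using fin free gap
proof (induction "card V" arbitrary: V rule: less_induct)
  case less
  note fin = less.prems(1) and free = less.prems(2)
  have k1: "1 \<le> k" using k by simp
  show ?case
  proof (cases "V = {}")
    case True
    then show ?thesis by simp
  next
    case False
    obtain C l where l: "1 \<le> l" "l \<le> k" and C: "is_cycle E C l" "C \<subseteq> V"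
      and lfree: "\<And>j. \<lbrakk>l < j; j \<le> Suc k\<rbrakk> \<Longrightarrow> cycle_free E V j"
      using longest_short_cycle[OF fin False free k1] by metis
    have freel: "cycle_free E V (Suc l)" using lfree l by simp
    note rc = remove_cycle[OF irr fin k1 free C l freel]
    have z: "gain k (card V) l = 0" "defect E C = 0" "(\<Sum>u\<in>V - C. deficit E C u) = 0"
      "gap k E (V - C) = 0"
      using rc(1,6,7,9,10) less.prems(3) by linarith+
    have NC: "cnt (nonadj E) C C = 0"
      using cnt_nonadj_le_defect[where E = E, OF rc(3) irr] z(2) cnt_nonneg[of "nonadj E" C C] by simp
    have NR: "cnt (nonadj E) (V - C) (V - C) = 0"
      using rc l fin z(4) by (intro less.hyps) auto
    obtain q r where n: "card V = q * k + r" "1 \<le> r" "r \<le> k"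
      using card_eq_residue[of k "card V"] k l rc(5) by auto
    have "l = k \<or> V = C"
    proof (rule ccontr)
      assume *: "\<not> (l = k \<or> V = C)"
      then have lk: "l < k" using l by simp
      have "l = r"
      proof (rule ccontr)
        assume "l \<noteq> r"
        then consider "l < r" | "r < l" by linarith
        then show False
        proof cases
          case 1
          then show False using gain_le[of l r k q] n z(1) l by simp
        next
          case 2
          then show False using gain_gt[of r l k q] n z(1) l lk rc(5) by simp
        qed
      qed
      then have cR: "card (V - C) = q * k" using rc(4) n by simp
      have "V - C \<noteq> {}" using * C by auto
      then have "1 \<le> q" using cR fin by (cases q) auto
      moreover have "cycle_free E (V - C) k" by (rule cycle_free_subset[OF lfree]) (use lk in auto)
      ultimately have "int k - 1 \<le> gap k E (V - C)"
        using fin cR by (intro gap_without_k_cycle[OF irr _ k1 rc(11)]) auto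
      then show False using z(4) k by simp
    qed
    then have "cnt (nonadj E) {u} C = 0" if "u \<in> V - C" for u
    proof
      assume lk: "l = k"
      have "deficit E C u = 0"
        using z(3) rc(8) fin that by (subst (asm) sum_nonneg_eq_0_iff) auto
      moreover have "cycle_free E (insert u C) (Suc l)"
        by (rule cycle_free_subset[OF freel]) (use that C in auto)
      ultimately show ?thesis
        using deficit_almost_complete[of E C l u] irr rc(2,3) lk k z(2) that by auto
    qed (use that in auto)
    then have "cnt (nonadj E) (V - C) C = 0"
      by (subst cnt_sum_left) simp
    then show ?thesis using cnt_nonadj_split[OF fin C(2), of E] NC NR by simp
  qed
qed

text \<open>A \<open>k\<close>-cycle exists by \<open>gap_without_k_cycle\<close>, is complete, and
  leaves a rest of gap 0; peeling off such cycles eventually reaches \<open>u\<close>.\<close>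

lemma clique_cover_of_gap_eq_0:
  assumes irr: "\<And>x. \<not> E x x" and fin: "finite V" and k: "3 \<le> k"
    and free: "cycle_free E V (Suc k)" and gap: "gap k E V = 0" and card: "card V = q * k"
    and u: "u \<in> V"
  obtains W where "W \<subseteq> V" "u \<in> W" "is_cycle E W k" "defect E W = 0"
proof -
  have k1: "1 \<le> k" using k by simp
  have "\<exists>W\<subseteq>V. u \<in> W \<and> is_cycle E W k \<and> defect E W = 0"
    using fin free gap card u
  proof (induction q arbitrary: V)
    case 0
    then show ?case by simp
  next
    case (Suc q)
    note fin = Suc.prems(1) and free = Suc.prems(2)
    have "\<not> cycle_free E V k"
      using gap_without_k_cycle[OF irr fin k1 free _ Suc.prems(4)] Suc.prems(3) k by auto
    then obtain C where C: "is_cycle E C k" "C \<subseteq> V" by (auto simp: cycle_free_def is_cycle_def)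
    note rc = remove_cycle[OF irr fin k1 free C k1 order_refl free]
    have z: "defect E C = 0" "gap k E (V - C) = 0"
      using rc(1,6,7,9,10) Suc.prems(3) by linarith+
    show ?case
    proof (cases "u \<in> C")
      case True
      then show ?thesis using C z by blast
    next
      case False
      have "\<exists>W\<subseteq>V - C. u \<in> W \<and> is_cycle E W k \<and> defect E W = 0"
        using fin rc(4,11) z False Suc.prems by (intro Suc.IH) auto
      then show ?thesis by blast
    qed
  qed
  then show ?thesis using that by blast
qed

text \<open>The pairs inside \<open>C\<close> are charged to its defect, the crossing pairs to the
  deficits (factor 2 for both orders), the others to the gap of the rest, all at the rate
  \<open>K\<close>. Whichever group is nonempty makes the inequality strict.\<close>

lemma nonadj_less_step:
  assumes irr: "\<And>x. \<not> E x x" and fin: "finite V" and C: "C \<subseteq> V" and B: "B \<subseteq> V" and K: "2 \<le> K"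
    and dn: "\<And>u. u \<in> V - C \<Longrightarrow> 0 \<le> deficit E C u"
    and du: "\<And>u. \<lbrakk>u \<in> B - C; 0 < cnt (nonadj E) {u} (B \<inter> C)\<rbrakk>
      \<Longrightarrow> 2 * cnt (nonadj E) {u} (B \<inter> C) < K * deficit E C u"
    and R: "0 < cnt (nonadj E) (B - C) (B - C) \<Longrightarrow> cnt (nonadj E) (B - C) (B - C) < K * gap k E (V - C)"
    and gR: "0 \<le> gap k E (V - C)"
    and eq: "defect E C + (\<Sum>u\<in>V - C. deficit E C u) + gap k E (V - C) \<le> gap k E V"
    and pos: "0 < cnt (nonadj E) B B"
  shows "cnt (nonadj E) B B < K * gap k E V"
proof -
  let ?N = "cnt (nonadj E)"
  have finB: "finite B" "finite C" using fin B C finite_subset by auto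
  have BC: "B - B \<inter> C = B - C" by auto
  have N: "?N B B = ?N (B \<inter> C) (B \<inter> C) + 2 * ?N (B - C) (B \<inter> C) + ?N (B - C) (B - C)"
    using cnt_nonadj_split[OF finB(1), of "B \<inter> C" E] BC by simp
  have d0: "0 \<le> defect E C" using defect_nonneg[of C E] irr finB by simp
  have 1: "?N (B \<inter> C) (B \<inter> C) \<le> K * defect E C"
    "0 < ?N (B \<inter> C) (B \<inter> C) \<Longrightarrow> ?N (B \<inter> C) (B \<inter> C) < K * defect E C"
  proof -
    have "?N (B \<inter> C) (B \<inter> C) \<le> ?N C C" using finB by (intro cnt_mono) auto
    then have le: "?N (B \<inter> C) (B \<inter> C) \<le> defect E C"
      using cnt_nonadj_le_defect[of C E] irr finB by fastforce
    have ge: "2 * defect E C \<le> K * defect E C" using K d0 by (intro mult_right_mono)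
    show "?N (B \<inter> C) (B \<inter> C) \<le> K * defect E C" using le ge d0 by linarith
    show "?N (B \<inter> C) (B \<inter> C) < K * defect E C" if "0 < ?N (B \<inter> C) (B \<inter> C)"
      using le ge d0 that by linarith
  qed
  have du': "2 * ?N {u} (B \<inter> C) \<le> K * deficit E C u" if "u \<in> B - C" for u
  proof (cases "0 < ?N {u} (B \<inter> C)")
    case True
    then show ?thesis using du that by fastforce
  next
    case False
    then have "?N {u} (B \<inter> C) = 0" using cnt_nonneg[of "nonadj E" "{u}" "B \<inter> C"] by linarith
    then show ?thesis using dn[of u] that B K by auto
  qed
  have sum: "(\<Sum>u\<in>B - C. K * deficit E C u) \<le> K * (\<Sum>u\<in>V - C. deficit E C u)"
    unfolding sum_distrib_left using fin B dn K by (intro sum_mono2) auto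
  have cr: "2 * ?N (B - C) (B \<inter> C) = (\<Sum>u\<in>B - C. 2 * ?N {u} (B \<inter> C))"
    by (subst cnt_sum_left) (simp add: sum_distrib_left)
  have "(\<Sum>u\<in>B - C. 2 * ?N {u} (B \<inter> C)) \<le> (\<Sum>u\<in>B - C. K * deficit E C u)"
    by (rule sum_mono) (rule du')
  then have 2: "2 * ?N (B - C) (B \<inter> C) \<le> K * (\<Sum>u\<in>V - C. deficit E C u)"
    using cr sum by linarith
  have two: "2 * ?N (B - C) (B \<inter> C) < K * (\<Sum>u\<in>V - C. deficit E C u)"
    if "0 < ?N (B - C) (B \<inter> C)"
  proof -
    have "\<exists>u\<in>B - C. 0 < ?N {u} (B \<inter> C)"
    proof (rule ccontr)
      assume "\<not> (\<exists>u\<in>B - C. 0 < ?N {u} (B \<inter> C))"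
      then have "(\<Sum>u\<in>B - C. ?N {u} (B \<inter> C)) \<le> 0" by (intro sum_nonpos) (meson not_less)
      then show False using that cnt_sum_left[of "nonadj E" "B - C" "B \<inter> C"] by linarith
    qed
    then have "(\<Sum>u\<in>B - C. 2 * ?N {u} (B \<inter> C)) < (\<Sum>u\<in>B - C. K * deficit E C u)"
    proof (intro sum_strict_mono_ex1 ballI)
      show "finite (B - C)" using finB by simp
      show "2 * ?N {u} (B \<inter> C) \<le> K * deficit E C u" if "u \<in> B - C" for u by (rule du'[OF that])
      assume "\<exists>u\<in>B - C. 0 < ?N {u} (B \<inter> C)"
      then show "\<exists>u\<in>B - C. 2 * ?N {u} (B \<inter> C) < K * deficit E C u" using du by blast
    qed
    then show ?thesis using cr sum by linarith
  qed
  have 3: "?N (B - C) (B - C) \<le> K * gap k E (V - C)"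
  proof (cases "0 < ?N (B - C) (B - C)")
    case False
    moreover have "0 \<le> K * gap k E (V - C)" using K gR by simp
    ultimately show ?thesis by linarith
  qed (use R in simp)
  have "K * (defect E C + (\<Sum>u\<in>V - C. deficit E C u) + gap k E (V - C)) \<le> K * gap k E V"
    using eq K by (intro mult_left_mono) auto
  then have tot: "K * defect E C + K * (\<Sum>u\<in>V - C. deficit E C u) + K * gap k E (V - C) \<le> K * gap k E V"
    by (simp add: distrib_left)
  consider "0 < ?N (B \<inter> C) (B \<inter> C)" | "0 < ?N (B - C) (B \<inter> C)" | "0 < ?N (B - C) (B - C)"
    using pos N by linarith
  then show ?thesis
    using 1 2 two 3 R N tot by cases linarith+
qed

lemma nonadj_le_card:
  assumes irr: "\<And>x. \<not> E x x" and fin: "finite B" and "card B \<le> b"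
  shows "cnt (nonadj E) B B \<le> int b * (int b - 1)"
proof (cases "card B = 0")
  case True
  then show ?thesis using fin by (cases b) (auto)
next
  case False
  have "cnt (nonadj E) B B \<le> int (card B) * (int (card B) - 1)"
    using fin by (intro cnt_le_irrefl) (auto simp: nonadj_def)
  also have "\<dots> \<le> int b * (int b - 1)" using assms False by (intro mult_mono) auto
  finally show ?thesis .
qed

text \<open>With the cycle spanning all of \<open>V\<close> nothing lies outside, so the gap
  dominates the defect of \<open>V\<close>.\<close>

lemma nonadj_le_gap_hamiltonian:
  assumes irr: "\<And>x. \<not> E x x" and fin: "finite V" and k: "1 \<le> k"
    and free: "cycle_free E V (Suc k)"
    and C: "is_cycle E V l" and l: "1 \<le> l" "l \<le> k"  and freel: "cycle_free E V (Suc l)"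
  shows "cnt (nonadj E) V V \<le> gap k E V"
proof -
  note rc = remove_cycle[where E = E, OF irr fin k free C order_refl l freel]
  show ?thesis using rc(1,6,9,10) cnt_nonadj_le_defect[where E = E, OF fin irr] by fastforce
qed

text \<open>If the bound fails, the gap is at most \<open>\<rho> - 2\<close>, since \<open>B\<close>
  has at most \<open>\<rho> * (\<rho> - 1)\<close> ordered pairs. So small a gap makes the removed
  cycle longer than \<open>\<rho>\<close> and nearly complete. Its removal changes the remainder to
  \<open>k + r - l\<close>, which is at least \<open>r\<close>; therefore \<open>\<rho>\<close>
  stays fixed while \<open>r\<close> varies in the induction.\<close>

lemma nonadj_less_gap_remainder:
  assumes irr: "\<And>x. \<not> E x x" and fin: "finite V" and k: "3 \<le> k"
    and free: "cycle_free E V (Suc k)"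
    and n: "card V = q * k + r" "1 \<le> r" "r \<le> k"
    and B: "B \<subseteq> V" "card B \<le> \<rho>" and \<rho>: "\<rho> \<le> r" "\<rho> < k"
    and pos: "0 < cnt (nonadj E) B B"
  shows "cnt (nonadj E) B B < (int \<rho> + 1) * gap k E V"
  using fin free n B \<rho>(1) pos
proof (induction "card V" arbitrary: V q r B rule: less_induct)
  case less
  note fin = less.prems(1) and free = less.prems(2) and n = less.prems(3-5) and B = less.prems(6,7)
    and \<rho>r = less.prems(8) and pos = less.prems(9)
  have k1: "1 \<le> k" using k by simp
  have finB: "finite B" using fin B finite_subset by blast
  show ?case
  proof (rule ccontr)
    assume "\<not> ?case"
    then have contr: "(int \<rho> + 1) * gap k E V \<le> cnt (nonadj E) B B" by simp
    have g0: "0 \<le> gap k E V" using gap_nonneg[where E = E, OF fin k1 irr free] .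
    have "gap k E V \<noteq> 0"
    proof
      assume "gap k E V = 0"
      then have "cnt (nonadj E) V V = 0" using nonadj_eq_0_of_gap_eq_0[where E = E, OF irr fin k free] by simp
      moreover have "cnt (nonadj E) B B \<le> cnt (nonadj E) V V" using fin B by (intro cnt_mono) auto
      ultimately show False using pos by simp
    qed
    then have g1: "1 \<le> gap k E V" using g0 by simp
    have le: "(int \<rho> + 1) * gap k E V \<le> int \<rho> * (int \<rho> - 1)"
      using contr nonadj_le_card[where E = E, OF irr finB B(2)] by linarith
    have g2: "gap k E V < int \<rho> - 1" if "2 \<le> \<rho>"
    proof (rule ccontr)
      assume "\<not> gap k E V < int \<rho> - 1"
      then have "(int \<rho> + 1) * (int \<rho> - 1) \<le> (int \<rho> + 1) * gap k E V"
        by (intro mult_left_mono) auto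
      then show False using le that by (simp add: algebra_simps)
    qed
    have \<rho>3: "3 \<le> \<rho>"
    proof (rule ccontr)
      assume "\<not> 3 \<le> \<rho>"
      then consider "\<rho> = 2" | "\<rho> \<le> 1" by linarith
      then show False
      proof cases
        case 1
        then show False using g2 g1 by simp
      next
        case 2
        then have "cnt (nonadj E) B B \<le> 0" using nonadj_le_card[where E = E and b = 1, OF irr finB] B(2) by simp
        then show False using pos by simp
      qed
    qed
    then have gap: "gap k E V \<le> int \<rho> - 2" using g2 by simp
    have "V \<noteq> {}" using pos B by auto
    then obtain C l where l: "1 \<le> l" "l \<le> k" and C: "is_cycle E C l" "C \<subseteq> V"
      and lfree: "\<And>j. \<lbrakk>l < j; j \<le> Suc k\<rbrakk> \<Longrightarrow> cycle_free E V j"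
      using longest_short_cycle[OF fin _ free k1] by metis
    have freel: "cycle_free E V (Suc l)" using lfree l by simp
    note rc = remove_cycle[where E = E, OF irr fin k1 free C l freel]
    have VC: "V \<noteq> C"
    proof
      assume "V = C"
      then have "cnt (nonadj E) V V \<le> gap k E V"
        using nonadj_le_gap_hamiltonian[where E = E, OF irr fin k1 free _ l freel] C by simp
      moreover have "cnt (nonadj E) B B \<le> cnt (nonadj E) V V" using fin B by (intro cnt_mono) auto
      moreover have "2 * gap k E V \<le> (int \<rho> + 1) * gap k E V"
        using \<rho>3 g1 by (intro mult_right_mono) auto
      ultimately show False using contr g1 by linarith
    qed
    then have card_pos: "1 \<le> card (V - C)"
      using C fin by (metis Diff_eq_empty_iff One_nat_def Suc_leI card_gt_0_iff finite_Diff subset_antisym)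
    \<comment> \<open>A shorter cycle has gain \<open>l * (r - l)\<close>, at least
      \<open>r - 1\<close>, which exceeds the gap.\<close>
    have lr: "r \<le> l"
    proof (rule ccontr)
      assume "\<not> r \<le> l"
      then have "int r - 1 \<le> gain k (card V) l"
        using gain_le[of l r k q] n mult_ge_sum_minus_1[of "int l" "int r - int l"] l by simp
      then show False using rc(1,7,9,10) gap \<rho>r by linarith
    qed
    \<comment> \<open>If \<open>l = r < k\<close>, the rest is a multiple of \<open>k\<close>
      without a \<open>k\<close>-cycle and alone costs \<open>k - 1\<close>.\<close>
    have lr2: "r < l \<or> l = k"
    proof (rule ccontr)
      assume "\<not> (r < l \<or> l = k)"
      then have lr': "l = r" "l < k" using lr l by auto
      then have cR: "card (V - C) = q * k" using rc(4) n by simp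
      moreover have "1 \<le> q" using cR card_pos by (cases q) auto
      moreover have "cycle_free E (V - C) k" by (rule cycle_free_subset[OF lfree]) (use lr' in auto)
      ultimately have "int k - 1 \<le> gap k E (V - C)"
        using fin by (intro gap_without_k_cycle[where E = E, OF irr _ k1 rc(11)]) auto
      then show False using rc(1,6,7,9) gap \<rho>r n by linarith
    qed
    then have \<rho>l: "\<rho> < l" using \<rho>r \<rho>(2) by auto
    have q: "1 \<le> q" using lr card_pos rc(4) n by (cases q) auto
    have cR: "card (V - C) = (q - 1) * k + (k + r - l)"
      using rc(4) n q l by (cases q) auto
    have defect: "defect E C \<le> int l - 3"
    proof (rule ccontr)
      assume "\<not> defect E C \<le> int l - 3"
      then have d: "int l - 2 \<le> defect E C" by simp
      show False
      proof (cases "l = k")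
        case True
        then show False using rc(1,6,9,10) gap \<rho>(2) d by linarith
      next
        case False
        then have "r < l" "l < k" using lr2 l by auto
        then have "1 \<le> gain k (card V) l"
          using gain_gt[of r l k q] n rc(5) mult_ge_sum_minus_1[of "int k - int l" "int l - int r"] by simp
        then show False using rc(1,9,10) gap \<rho>l d by linarith
      qed
    qed
    have "cnt (nonadj E) B B < (int \<rho> + 1) * gap k E V"
    proof (rule nonadj_less_step[where E = E, OF irr fin C(2) B(1) _ rc(8) _ _ rc(10) _ pos])
      show "2 \<le> int \<rho> + 1" using \<rho>3 by simp
      show "defect E C + (\<Sum>u\<in>V - C. deficit E C u) + gap k E (V - C) \<le> gap k E V"
        using rc(1,6) by simp
      show "cnt (nonadj E) (B - C) (B - C) < (int \<rho> + 1) * gap k E (V - C)"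
        if "0 < cnt (nonadj E) (B - C) (B - C)"
      proof (rule less.hyps[OF _ _ rc(11) cR _ _ _ _ _ that])
        show "card (V - C) < card V" using rc(4,5) l by simp
        show "finite (V - C)" using fin by simp
        show "1 \<le> k + r - l" "k + r - l \<le> k" "\<rho> \<le> k + r - l" using n l lr \<rho>r by auto
        show "B - C \<subseteq> V - C" using B by auto
        show "card (B - C) \<le> \<rho>" using B(2) finB card_mono[of B "B - C"] by auto
      qed
      fix u assume u: "u \<in> B - C" and p: "0 < cnt (nonadj E) {u} (B \<inter> C)"
      have "cycle_free E (insert u C) (Suc l)"
        by (rule cycle_free_subset[OF freel]) (use u B C in auto)
      then consider "deficit E C u = cnt (nonadj E) {u} C" | "deficit E C u = int l - 2"
        using deficit_almost_complete[where E = E, OF irr rc(3,2) _ defect] u \<rho>3 \<rho>l by auto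
      then show "2 * cnt (nonadj E) {u} (B \<inter> C) < (int \<rho> + 1) * deficit E C u"
      proof cases
        case 1
        have "cnt (nonadj E) {u} (B \<inter> C) \<le> cnt (nonadj E) {u} C" using rc(3) by (intro cnt_mono) auto
        moreover have "3 * cnt (nonadj E) {u} C \<le> (int \<rho> + 1) * cnt (nonadj E) {u} C"
          using \<rho>3 by (intro mult_right_mono) auto
        ultimately show ?thesis using p unfolding 1 by linarith
      next
        case 2
        \<comment> \<open>As \<open>u\<close> itself lies in \<open>B\<close> outside
          \<open>C\<close>, at most \<open>\<rho> - 1\<close> of its nonneighbours count, whereas
          the exceptional deficit \<open>l - 2\<close> is at least 2 because
          \<open>l > \<rho> \<ge> 3\<close>.\<close>
        have "card (B \<inter> C) < card B" using u finB by (intro psubset_card_mono) auto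
        then have "cnt (nonadj E) {u} (B \<inter> C) \<le> int \<rho> - 1"
          using cnt_le_card[of "nonadj E" "{u}" "B \<inter> C"] B(2) by simp
        moreover have "(int \<rho> + 1) * 2 \<le> (int \<rho> + 1) * (int l - 2)"
          using \<rho>3 \<rho>l by (intro mult_left_mono) auto
        ultimately show ?thesis using 2 by simp
      qed
    qed
    then show False using contr by simp
  qed
qed

text \<open>Lacking a \<open>k\<close>-cycle costs \<open>k - 1\<close>, and having one costs at
  least its defect. Applied with the smallest defect of a \<open>k\<close>-cycle in a larger set,
  this gives a uniform lower bound on the gaps of its subsets.\<close>

lemma gap_ge_min_defect:
  assumes irr: "\<And>x. \<not> E x x" and fin: "finite V" and k: "1 \<le> k"
    and free: "cycle_free E V (Suc k)" and card: "card V = q * k" "1 \<le> q"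
    and d: "d \<le> int k - 1" "\<And>C. \<lbrakk>is_cycle E C k; C \<subseteq> V\<rbrakk> \<Longrightarrow> d \<le> defect E C"
  shows "d \<le> gap k E V"
proof (cases "cycle_free E V k")
  case True
  then show ?thesis using gap_without_k_cycle[where E = E, OF irr fin k free True card] d by simp
next
  case False
  then obtain C where C: "is_cycle E C k" "C \<subseteq> V" by (auto simp: cycle_free_def is_cycle_def)
  note rc = remove_cycle[where E = E, OF irr fin k free C k order_refl free]
  show ?thesis using rc(1,6,9,10) d(2)[OF C] by linarith
qed

text \<open>The inductive step of \<open>nonadj_less_gap\<close> for a \<open>k\<close>-cycle so
  close to complete that \<open>deficit_almost_complete\<close> applies.\<close>

lemma nonadj_less_gap_step:
  assumes irr: "\<And>x. \<not> E x x" and fin: "finite V" and k: "3 \<le> k"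
    and free: "cycle_free E V (Suc k)" and card: "card V = q * k"
    and B: "B \<subseteq> V" "card B \<le> k" and pos: "0 < cnt (nonadj E) B B"
    and C: "is_cycle E C k" "C \<subseteq> V" and defect: "defect E C \<le> int k - 3"
    and IH: "0 < cnt (nonadj E) (B - C) (B - C) \<Longrightarrow>
      cnt (nonadj E) (B - C) (B - C) < int k * gap k E (V - C)"
  shows "cnt (nonadj E) B B < int k * gap k E V"
proof -
  have k1: "1 \<le> k" using k by simp
  have finB: "finite B" using fin B finite_subset by blast
  note rc = remove_cycle[where E = E, OF irr fin k1 free C k1 order_refl free]
  let ?N = "cnt (nonadj E)"
  have cases: "deficit E C u = ?N {u} C \<or> deficit E C u = int k - 2" if "u \<in> V - C" for u
  proof -
    have "cycle_free E (insert u C) (Suc k)"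
      by (rule cycle_free_subset[OF free]) (use that C in auto)
    then show ?thesis
      using deficit_almost_complete[where E = E, OF irr rc(3,2) k defect] that by auto
  qed
  have le: "?N {u} (B \<inter> C) \<le> ?N {u} C" for u using rc(3) by (intro cnt_mono) auto
  \<comment> \<open>A vertex joined to \<open>C\<close> by a single mutual pair of arcs has deficit \<open>k - 2\<close> but \<open>k - 1\<close>
    nonneighbours in \<open>C\<close>. Only for \<open>k = 3\<close> this is too expensive; then a second clique through that
    vertex provides the missing deficits.\<close>
  show ?thesis
  proof (cases "k = 3 \<and> (\<exists>u\<in>B - C. 2 \<le> ?N {u} (B \<inter> C))")
    case False
    show ?thesis
    proof (rule nonadj_less_step[where E = E, OF irr fin C(2) B(1) _ rc(8) _ IH rc(10) _ pos])
      show "2 \<le> int k" using k by simp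
      show "defect E C + (\<Sum>u\<in>V - C. deficit E C u) + gap k E (V - C) \<le> gap k E V"
        using rc(1,6) by simp
      fix u assume u: "u \<in> B - C" and p: "0 < ?N {u} (B \<inter> C)"
      then have "u \<in> V - C" using B by auto
      from cases[OF this] show "2 * ?N {u} (B \<inter> C) < int k * deficit E C u"
      proof
        assume eq: "deficit E C u = ?N {u} C"
        have "3 * ?N {u} C \<le> int k * ?N {u} C" using k by (intro mult_right_mono) auto
        then show ?thesis using le[of u] p unfolding eq by linarith
      next
        assume eq: "deficit E C u = int k - 2"
        show ?thesis
        proof (cases "k = 3")
          case True
          then have "?N {u} (B \<inter> C) < 2" using False u by (auto simp: not_le)
          then show ?thesis using eq True by simp
        next
          case k3: False
          have "card (B \<inter> C) < card B" using u finB by (intro psubset_card_mono) auto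
          then have "?N {u} (B \<inter> C) \<le> int k - 1"
            using cnt_le_card[of "nonadj E" "{u}" "B \<inter> C"] B(2) by simp
          moreover have "int k * 2 \<le> int k * (int k - 2)"
            using k3 k by (intro mult_left_mono) auto
          ultimately show ?thesis unfolding eq by simp
        qed
      qed
    qed
  next
    case True
    then obtain u where k3: "k = 3" and u: "u \<in> B" "u \<notin> C" and u2: "2 \<le> ?N {u} (B \<inter> C)" by auto
    have uV: "u \<in> V - C" using u B by auto
    have "?N {u} (B \<inter> C) \<le> int (card (B \<inter> C))"
      using cnt_le_card[of "nonadj E" "{u}" "B \<inter> C"] by simp
    then have x: "2 \<le> card (B \<inter> C)" using u2 by simp
    have "card B = card (B \<inter> C) + card (B - C)" using finB by (metis card_Int_Diff)
    moreover have "1 \<le> card (B - C)" using u finB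
      by (metis DiffI One_nat_def Suc_leI card_gt_0_iff empty_iff finite_Diff)
    ultimately have xy: "card (B \<inter> C) = 2" "card (B - C) = 1" using x B(2) k3 by auto
    have d0: "defect E C = 0" using defect rc(7) k3 by simp
    have "?N (B \<inter> C) (B \<inter> C) \<le> ?N C C" using rc(3) by (intro cnt_mono) auto
    then have NC: "?N (B \<inter> C) (B \<inter> C) \<le> 0"
      using cnt_nonadj_le_defect[where E = E, OF rc(3) irr] d0 by simp
    have NB: "?N (B - C) (B - C) \<le> 0"
      using nonadj_le_card[where E = E and b = 1, OF irr, of "B - C"] finB xy by simp
    have NX: "?N (B - C) (B \<inter> C) \<le> 2" using cnt_le_card[of "nonadj E" "B - C" "B \<inter> C"] xy by simp
    have "B - B \<inter> C = B - C" by auto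
    then have N4: "?N B B \<le> 4" using cnt_nonadj_split[OF finB, of "B \<inter> C" E] NC NB NX by simp
    \<comment> \<open>At most 4 ordered pairs remain, so a gap of 2 at the rate \<open>k = 3\<close>
      suffices.\<close>
    have "2 \<le> gap k E V"
    proof (rule ccontr)
      assume "\<not> 2 \<le> gap k E V"
      then have g: "gap k E V \<le> 1" by simp
      have "1 \<le> deficit E C u" using cases[OF uV] le[of u] u2 k3 by auto
      moreover have "deficit E C u \<le> (\<Sum>u\<in>V - C. deficit E C u)"
        using member_le_sum[of u "V - C" "deficit E C"] uV rc(8) fin by auto
      ultimately have "gap k E (V - C) = 0" using rc(1,6,7,10) g by linarith
      moreover have "card (V - C) = (q - 1) * k" using rc(4) card by (simp add: diff_mult_distrib)
      \<comment> \<open>The deficit of \<open>u\<close> uses up the whole gap, so the rest is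
        extremal and has a complete \<open>k\<close>-cycle through \<open>u\<close>. Removing
        \<open>W\<close> in place of \<open>C\<close> exposes two vertices of positive
        deficit.\<close>
      ultimately obtain W where W: "W \<subseteq> V - C" "u \<in> W" "is_cycle E W k" "defect E W = 0"
        using clique_cover_of_gap_eq_0[where E = E, OF irr _ k rc(11) _ _ uV] fin by (metis finite_Diff)
      have WV: "W \<subseteq> V" using W by auto
      note rw = remove_cycle[where E = E, OF irr fin k1 free W(3) WV k1 order_refl free]
      have "\<not> (\<forall>z\<in>B \<inter> C. \<forall>w\<in>B \<inter> C. z = w \<or> \<not> (nonadj E u z \<and> nonadj E u w))"
      proof
        assume *: "\<forall>z\<in>B \<inter> C. \<forall>w\<in>B \<inter> C. z = w \<or> \<not> (nonadj E u z \<and> nonadj E u w)"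
        have "card {z \<in> B \<inter> C. nonadj E u z} \<le> 1"
          using * finB by (auto simp: card_le_Suc0_iff_eq)
        moreover have "?N {u} (B \<inter> C) = int (card {z \<in> B \<inter> C. nonadj E u z})"
          using finB by (simp add: cnt_def sum_of_bool_eq Int_def)
        ultimately show False using u2 by simp
      qed
      then obtain z w where zw: "z \<in> C" "w \<in> C" "z \<noteq> w" "nonadj E u z" "nonadj E u w" by auto
      have def: "1 \<le> deficit E W z" if "z \<in> C" "nonadj E u z" for z
      proof -
        have zW: "z \<notin> W" using that W by auto
        have "1 \<le> ?N {z} W"
          using cnt_pos[of "{z}" W z u "nonadj E"] rw(3) W that nonadj_sym[of E u z] by auto
        moreover have "cycle_free E (insert z W) (Suc k)"
          by (rule cycle_free_subset[OF free]) (use that C WV in auto)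
        ultimately show ?thesis
          using deficit_almost_complete[where E = E, OF irr rw(3,2) k, of z] W(4) k3 zW by auto
      qed
      have zwV: "z \<in> V - W" "w \<in> V - W" using zw C W by auto
      have "(\<Sum>u\<in>{z, w}. deficit E W u) \<le> (\<Sum>u\<in>V - W. deficit E W u)"
        using zwV rw(8) fin by (intro sum_mono2) auto
      then have "2 \<le> (\<Sum>u\<in>V - W. deficit E W u)"
        using def[of z] def[of w] zw by simp
      then show False using g rw(1,6,7,10) by linarith
    qed
    then show ?thesis using N4 k3 by simp
  qed
qed

text \<open>Failure bounds the gap by \<open>k - 1\<close>. Without a \<open>k\<close>-cycle this is
  all spent on the gain, and only crossing pairs remain, which are too few. Otherwise a
  \<open>k\<close>-cycle of least defect either is nearly complete, which is the previous lemma, or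
  forces \<open>k = 3\<close> and two blocks, where parity decides.\<close>

lemma nonadj_less_gap:
  assumes irr: "\<And>x. \<not> E x x" and fin: "finite V" and k: "3 \<le> k"
    and free: "cycle_free E V (Suc k)"
    and card: "card V = q * k" and B: "B \<subseteq> V" "card B \<le> k"
    and pos: "0 < cnt (nonadj E) B B"
  shows "cnt (nonadj E) B B < int k * gap k E V"
  using fin free card B pos
proof (induction q arbitrary: V B)
  case 0
  then show ?case by simp
next
  case (Suc q)
  note fin = Suc.prems(1) and free = Suc.prems(2) and card = Suc.prems(3) and B = Suc.prems(4,5)
    and pos = Suc.prems(6)
  let ?N = "cnt (nonadj E)"
  have k1: "1 \<le> k" using k by simp
  have finB: "finite B" using fin B finite_subset by blast
  have IH: "?N (B - C) (B - C) < int k * gap k E (V - C)"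
    if "is_cycle E C k" "C \<subseteq> V" "0 < ?N (B - C) (B - C)" for C
  proof -
    note rc = remove_cycle[where E = E, OF irr fin k1 free that(1,2) k1 order_refl free]
    have "card (B - C) \<le> k" using B(2) finB card_mono[of B "B - C"] by auto
    then show ?thesis using fin rc(4) card B(1) that(3) by (intro Suc.IH rc(11)) auto
  qed
  have Nle: "?N B B \<le> int k * (int k - 1)" using nonadj_le_card[where E = E, OF irr finB B(2)] .
  have NBV: "?N B B \<le> ?N V V" using fin B by (intro cnt_mono) auto
  \<comment> \<open>By \<open>4 * x * y \<le> (x + y)^2\<close> at most \<open>k^2 / 4\<close> pairs
    cross, and \<open>k^2 / 2 < k * (k - 1)\<close> for \<open>k \<ge> 3\<close>.\<close>
  have xy: "2 * ?N (B - C) (B \<inter> C) < int k * (int k - 1)" for C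
  proof -
    define x where "x = int (card (B \<inter> C))"
    define y where "y = int (card (B - C))"
    have "x + y \<le> int k" using B(2) finB card_Int_Diff[of B C] by (simp add: x_def y_def)
    then have "(x + y) * (x + y) \<le> int k * int k" by (intro mult_mono) (auto simp: x_def y_def)
    moreover have "0 \<le> (x - y) * (x - y)" by simp
    ultimately have "4 * (y * x) \<le> int k * int k" by (simp add: algebra_simps)
    moreover have "?N (B - C) (B \<inter> C) \<le> y * x"
      using cnt_le_card[of "nonadj E" "B - C" "B \<inter> C"] by (simp add: x_def y_def)
    moreover have "3 * int k \<le> int k * int k" using k by (intro mult_right_mono) auto
    ultimately have "4 * ?N (B - C) (B \<inter> C) < 2 * (int k * int k) - 2 * int k" using k by linarith
    then show ?thesis by (simp add: algebra_simps)
  qed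
  have split: "?N B B = ?N (B \<inter> C) (B \<inter> C) + 2 * ?N (B - C) (B \<inter> C) + ?N (B - C) (B - C)" for C
  proof -
    have "B - B \<inter> C = B - C" by auto
    then show ?thesis using cnt_nonadj_split[OF finB, of "B \<inter> C" E] by simp
  qed
  show ?case
  proof (rule ccontr)
    assume "\<not> ?case"
    then have contr: "int k * gap k E V \<le> ?N B B" by simp
    have g0: "0 \<le> gap k E V" using gap_nonneg[where E = E, OF fin k1 irr free] .
    have "gap k E V \<noteq> 0"
      using nonadj_eq_0_of_gap_eq_0[where E = E, OF irr fin k free] NBV pos by auto
    then have g1: "1 \<le> gap k E V" using g0 by simp
    have gk: "gap k E V \<le> int k - 1"
    proof (rule ccontr)
      assume "\<not> ?thesis"
      then have "int k * int k \<le> int k * gap k E V" by (intro mult_left_mono) auto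
      then show False using contr Nle k unfolding right_diff_distrib by linarith
    qed
    have no_single: "\<not> is_cycle E V k"
    proof
      assume "is_cycle E V k"
      then have "?N V V \<le> gap k E V"
        using nonadj_le_gap_hamiltonian[where E = E, OF irr fin k1 free _ k1 order_refl free] by simp
      moreover have "2 * gap k E V \<le> int k * gap k E V"
        using k g1 by (intro mult_right_mono) auto
      ultimately show False using contr g1 NBV by linarith
    qed
    have has: "\<not> cycle_free E V k"
    proof
      assume kfree: "cycle_free E V k"
      have "V \<noteq> {}" using card k by auto
      then obtain C l where l: "1 \<le> l" "l \<le> k" and C: "is_cycle E C l" "C \<subseteq> V"
        and lfree: "\<And>j. \<lbrakk>l < j; j \<le> Suc k\<rbrakk> \<Longrightarrow> cycle_free E V j"
        using longest_short_cycle[OF fin _ free k1] by metis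
      have freel: "cycle_free E V (Suc l)" using lfree l by simp
      note rc = remove_cycle[where E = E, OF irr fin k1 free C l freel]
      have lk: "l < k" using is_cycle_not_free[OF C] kfree l by (metis le_neq_implies_less)
      then have "int k - 1 \<le> gain k (card V) l"
        using gain_le[of l k k q] card mult_ge_sum_minus_1[of "int l" "int k - int l"] l
        by (simp add: add.commute)
      \<comment> \<open>The gain alone exhausts the gap, so all other terms vanish.\<close>
      then have z: "gap k E V = int k - 1" "defect E C = 0" "gap k E (V - C) = 0"
        using rc(1,7,9,10) gk by linarith+
      have "?N (B \<inter> C) (B \<inter> C) \<le> ?N C C" using rc(3) by (intro cnt_mono) auto
      then have "?N (B \<inter> C) (B \<inter> C) \<le> 0"
        using cnt_nonadj_le_defect[where E = E, OF rc(3) irr] z by simp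
      moreover have "?N (B - C) (B - C) \<le> ?N (V - C) (V - C)"
        using fin B by (intro cnt_mono) auto
      moreover have "?N (V - C) (V - C) = 0"
        using nonadj_eq_0_of_gap_eq_0[where E = E, OF irr _ k rc(11) z(3)] fin by simp
      ultimately have "?N B B \<le> 2 * ?N (B - C) (B \<inter> C)" using split[of C] by linarith
      then show False using xy[of C] contr z(1) by simp
    qed
    \<comment> \<open>By choosing a cycle of minimal defect, a large defect is inherited by the cycles in the rest.\<close>
    obtain C1 where C1: "is_cycle E C1 k \<and> C1 \<subseteq> V"
      using has by (auto simp: cycle_free_def is_cycle_def)
    obtain C where C0: "(is_cycle E C k \<and> C \<subseteq> V) \<and> (\<forall>D. is_cycle E D k \<and> D \<subseteq> V \<longrightarrow>
      nat (defect E C) \<le> nat (defect E D))"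
      using ex_has_least_nat[of "\<lambda>C. is_cycle E C k \<and> C \<subseteq> V" C1 "\<lambda>C. nat (defect E C)", OF C1] by (rule exE)
    have C: "is_cycle E C k" "C \<subseteq> V"
      by (rule conjunct1[OF conjunct1[OF C0]], rule conjunct2[OF conjunct1[OF C0]])
    have min_nat: "nat (defect E C) \<le> nat (defect E D)" if "is_cycle E D k" "D \<subseteq> V" for D
      by (rule mp[OF spec[OF conjunct2[OF C0]] conjI[OF that]])
    have dpos: "0 \<le> defect E D" if "D \<subseteq> V" for D
      using defect_nonneg[where E = E, OF finite_subset[OF that fin] irr] .
    have min: "defect E C \<le> defect E D" if "is_cycle E D k" "D \<subseteq> V" for D
      using min_nat[OF that] dpos[OF that(2)] by linarith
    note rc = remove_cycle[where E = E, OF irr fin k1 free C k1 order_refl free]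
    show False
    proof (cases "defect E C \<le> int k - 3")
      case True
      then show False
        using nonadj_less_gap_step[where E = E, OF irr fin k free card B pos C True IH[OF C]] contr by simp
    next
      case False
      have floor: "min (int k - 1) (defect E C) \<le> gap k E W" if W: "W \<subseteq> V" "card W = p * k" "1 \<le> p" for W p
      proof (rule gap_ge_min_defect[where E = E, OF irr finite_subset[OF W(1) fin] k1
            cycle_free_subset[OF free W(1)] W(2,3)])
        show "min (int k - 1) (defect E C) \<le> defect E D" if "is_cycle E D k" "D \<subseteq> W" for D
          using min[OF that(1)] that(2) W(1) by fastforce
      qed simp
      have cR: "card (V - C) = q * k" using rc(4) card by simp
      have "V \<noteq> C" using no_single C by auto
      then have q: "1 \<le> q" using cR C fin by (cases q) auto
      have gR: "min (int k - 1) (defect E C) \<le> gap k E (V - C)" using floor[OF _ cR q] by auto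
      \<comment> \<open>The defect of \<open>C\<close> and the gap of the rest are both at least
        \<open>k - 2\<close> and sum to at most \<open>k - 1\<close>.\<close>
      then have *: "k = 3" "defect E C = 1" "gap k E (V - C) = 1" "gap k E V = 2"
        using rc(1,6,9,10) gk False k by (auto simp: min_def split: if_splits)
      have "\<not> cycle_free E (V - C) k"
        using gap_without_k_cycle[where E = E, OF irr _ k1 rc(11) _ cR q] fin * by auto
      then obtain D where D: "is_cycle E D k" "D \<subseteq> V - C" by (auto simp: cycle_free_def is_cycle_def)
      have DV: "D \<subseteq> V" using D by auto
      have finR: "finite (V - C)" using fin by simp
      note rd = remove_cycle[where E = E, OF irr finR k1 rc(11) D k1 order_refl rc(11)]
      \<comment> \<open>A third block would bring a further gap of at least 1, next to the defect of
        \<open>D\<close>, into a rest whose gap is only 1.\<close>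
      have "q = 1"
      proof (rule ccontr)
        assume "q \<noteq> 1"
        then have "1 \<le> q - 1" using q by simp
        moreover have "card (V - C - D) = (q - 1) * k" using rd(4) cR by (simp add: diff_mult_distrib)
        ultimately have "min (int k - 1) (defect E C) \<le> gap k E (V - C - D)"
          using floor[of "V - C - D"] by blast
        then show False using rd(1,6,9) min[OF D(1) DV] * by simp
      qed
      then have "D = V - C"
        using D(2) rd(2) cR finR by (intro card_subset_eq) auto
      then have "?N (V - C) (V - C) \<le> 1"
        using nonadj_le_gap_hamiltonian[where E = E, OF irr finR k1 rc(11) _ k1 order_refl rc(11)] D * by simp
      moreover have "?N (B - C) (B - C) \<le> ?N (V - C) (V - C)" using fin B by (intro cnt_mono) auto
      \<comment> \<open>A bound by 1 means 0, as nonadjacent pairs count twice.\<close>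
      ultimately have NR: "?N (B - C) (B - C) \<le> 0"
        using cnt_nonadj_pos_ge_2[of "B - C" E] finB by fastforce
      have "?N (B \<inter> C) (B \<inter> C) \<le> ?N C C" using rc(3) by (intro cnt_mono) auto
      also have "\<dots> \<le> 1" using cnt_nonadj_le_defect[where E = E, OF rc(3) irr] * by simp
      finally have "?N (B \<inter> C) (B \<inter> C) \<le> 0"
        using cnt_nonadj_pos_ge_2[of "B \<inter> C" E] finB by fastforce
      then have "?N B B < 6" using NR split[of C] xy[of C] * by simp
      then show False using contr * by simp
    qed
  qed
qed

section \<open>The energy of a digraph without long cycles\<close>

definition energy :: "('a \<Rightarrow> 'a \<Rightarrow> bool) \<Rightarrow> 'a set \<Rightarrow> int" where
  "energy E V = (\<Sum>u\<in>V. (cnt E {u} V)\<^sup>2) + cnt (\<lambda>x y. E x y \<and> E y x) V V"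

definition max_deg :: "nat \<Rightarrow> nat \<Rightarrow> nat \<Rightarrow> int" where
  "max_deg k n i = int n - 1 - int i + int (i mod k)"

definition max_energy :: "nat \<Rightarrow> nat \<Rightarrow> int" where
  "max_energy k n = (\<Sum>i<n. (max_deg k n i)\<^sup>2 + 2 * int (i mod k))"

lemma sum_lessThan_int: "2 * (\<Sum>i<n. int i) = int n * (int n - 1)"
  by (induction n) (simp_all add: algebra_simps)

text \<open>\<open>max_deg k n\<close> is the outdegree sequence of the extremal digraph in the same listing, and
  \<open>i mod k\<close> counts the mutual arcs between \<open>i\<close> and its predecessors.\<close>

lemma sum_max_deg: "(\<Sum>i<j. max_deg k n i) = int j * (int n - int j) + max_arcs k j"
proof -
  have "(\<Sum>i<j. max_deg k n i) = (\<Sum>i<j. (int n - 1) - 2 * int i + (int i + int (i mod k)))"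
    by (intro sum.cong) (auto simp: max_deg_def)
  also have "\<dots> = int j * (int n - 1) - 2 * (\<Sum>i<j. int i) + max_arcs k j"
    by (simp add: sum.distrib sum_subtractf sum_distrib_left max_arcs_def right_diff_distrib)
  also have "\<dots> = int j * (int n - int j) + max_arcs k j"
    unfolding sum_lessThan_int by (simp add: algebra_simps)
  finally show ?thesis .
qed

lemma abel_summation:
  fixes p g :: "nat \<Rightarrow> int"
  shows "(\<Sum>i<Suc m. p i * g i)
    = (\<Sum>j<m. (\<Sum>i<Suc j. p i) * (g j - g (Suc j))) + (\<Sum>i<Suc m. p i) * g m"
  by (induction m) (simp_all add: algebra_simps)

text \<open>\<open>Suc j\<close> runs from 1 to \<open>q * k + s\<close>, and \<open>s < k\<close>
  keeps out the next multiple of \<open>k\<close>.\<close>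

lemma sum_over_multiples:
  fixes f :: "nat \<Rightarrow> int"
  assumes "s < k"
  shows "(\<Sum>j<q * k + s. if k dvd Suc j then f (Suc j) else 0) = (\<Sum>J<q. f (Suc J * k))"
proof -
  have no: "\<not> k dvd Suc (q * k + t)" if "Suc t < k" for q t
  proof -
    have "Suc (q * k + t) mod k = Suc t"
      using that by (metis add_Suc_right mod_less mod_mult_self3)
    then show ?thesis by (simp add: dvd_eq_mod_eq_0)
  qed
  have A: "(\<Sum>j<q * k + s. if k dvd Suc j then f (Suc j) else 0)
      = (\<Sum>j<q * k. if k dvd Suc j then f (Suc j) else 0)" if "s < k" for q s
    using that
  proof (induction s)
    case (Suc s)
    then show ?case using no[of s q] by simp
  qed simp
  have "(\<Sum>j<q * k. if k dvd Suc j then f (Suc j) else 0) = (\<Sum>J<q. f (Suc J * k))"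
  proof (induction q)
    case (Suc q)
    have k: "Suc q * k = Suc (q * k + (k - 1))" using assms by simp
    have dv: "k dvd Suc (q * k + (k - 1))" by (metis k dvd_triv_right)
    have "(\<Sum>j<Suc q * k. if k dvd Suc j then f (Suc j) else 0)
        = (\<Sum>j<q * k + (k - 1). if k dvd Suc j then f (Suc j) else 0) + f (Suc q * k)"
      unfolding k using dv by (simp only: sum.lessThan_Suc if_True)
    then show ?case using A[of "k - 1" q] Suc assms by simp
  qed simp
  then show ?thesis using A[OF assms, of q] by simp
qed

text \<open>\<open>max_deg k n i\<close> equals \<open>n - 1 - (i div k) * k\<close>: it is constant
  on each block and drops only where a new block starts.\<close>

lemma max_deg_diff:
  assumes "1 \<le> k"
  shows "max_deg k n j - max_deg k n (Suc j) = (if k dvd Suc j then int k else 0)"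
proof (cases "k dvd Suc j")
  case True
  then have "Suc j mod k = 0" by simp
  moreover have "Suc (j mod k) = k"
    using \<open>Suc j mod k = 0\<close> assms by (metis mod_Suc nat.distinct(1))
  ultimately show ?thesis using True by (simp add: max_deg_def)
next
  case False
  then have "Suc j mod k \<noteq> 0" by (simp add: dvd_eq_mod_eq_0)
  then have "Suc j mod k = Suc (j mod k)" by (metis mod_Suc)
  then show ?thesis using False by (simp add: max_deg_def)
qed

section \<open>Outdegree sequences and slacks along an enumeration of the vertices\<close>

locale enumerated_digraph =
  fixes E :: "'a \<Rightarrow> 'a \<Rightarrow> bool" and V :: "'a set" and n :: nat and v :: "nat \<Rightarrow> 'a"
  assumes irr: "\<And>x. \<not> E x x" and bij: "bij_betw v {..<n} V"
begin

definition S :: "nat \<Rightarrow> 'a set" where "S j = v ` {..<j}"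

definition d :: "nat \<Rightarrow> int" where "d i = cnt E {v i} V"

definition slack :: "nat \<Rightarrow> nat \<Rightarrow> int" where "slack k j = (\<Sum>i<j. max_deg k n i - d i)"

lemma fin: "finite V" and card_V: "card V = n" and V_eq: "V = v ` {..<n}" and inj: "inj_on v {..<n}"
  using bij bij_betw_finite bij_betw_same_card[OF bij] by (auto simp: bij_betw_def)

lemma S_n: "S n = V" by (simp add: S_def V_eq)

lemma S_subset: "j \<le> n \<Longrightarrow> S j \<subseteq> V" by (auto simp: S_def V_eq)

lemma S_mono: "i \<le> j \<Longrightarrow> S i \<subseteq> S j" by (auto simp: S_def)

lemma finite_S [simp]: "finite (S j)" by (simp add: S_def)

lemma card_S: "j \<le> n \<Longrightarrow> card (S j) = j"
  unfolding S_def by (subst card_image) (auto intro: inj_on_subset[OF inj])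

lemma v_in_S_iff: "\<lbrakk>i < n; j \<le> n\<rbrakk> \<Longrightarrow> v i \<in> S j \<longleftrightarrow> i < j"
  by (auto simp: S_def dest: inj_onD[OF inj])

lemma sum_d: "j \<le> n \<Longrightarrow> (\<Sum>i<j. d i) = cnt E (S j) V"
  unfolding d_def S_def by (subst cnt_sum_left) (simp add: sum.reindex[OF inj_on_subset[OF inj]])

text \<open>\<open>slack k j\<close> measures how far the first \<open>j\<close> outdegrees are from the extremal ones in the
  majorization order.\<close>

lemma slack_eq:
  assumes "j \<le> n"
  shows "slack k j = gap k E (S j) + (int j * (int n - int j) - cnt E (S j) (V - S j))"
proof -
  have V: "V = S j \<union> (V - S j)" using S_subset[OF assms] by auto
  have "cnt E (S j) (S j \<union> (V - S j)) = cnt E (S j) (S j) + cnt E (S j) (V - S j)"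
    using fin by (intro cnt_union_right) auto
  then have "cnt E (S j) V = cnt E (S j) (S j) + cnt E (S j) (V - S j)" using V by simp
  then show ?thesis
    using sum_d[OF assms] sum_max_deg[of k n j] card_S[OF assms]
    by (simp add: slack_def sum_subtractf gap_def)
qed

text \<open>A pair is never both a forward arc and nonadjacent, so each nonadjacent pair across the
  cut is a missing forward arc.\<close>

lemma cnt_cross:
  assumes "j \<le> n"
  shows "cnt E (S j) (V - S j) + cnt (nonadj E) (S j) (V - S j) \<le> int j * (int n - int j)"
proof -
  have "cnt E (S j) (V - S j) + cnt (nonadj E) (S j) (V - S j)
      = cnt (\<lambda>x y. E x y \<or> nonadj E x y) (S j) (V - S j)"
    unfolding cnt_def sum.distrib[symmetric] by (intro sum.cong) (auto simp: nonadj_def)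
  also have "\<dots> \<le> int (card (S j)) * int (card (V - S j))" by (rule cnt_le_card)
  also have "card (V - S j) = n - j"
    using S_subset[OF assms] card_S[OF assms] card_V by (simp add: card_Diff_subset)
  finally show ?thesis using card_S[OF assms] assms by (simp add: of_nat_diff)
qed

lemma slack_ge:
  "j \<le> n \<Longrightarrow> gap k E (S j) + cnt (nonadj E) (S j) (V - S j) \<le> slack k j"
  using slack_eq[of j k] cnt_cross[of j] by simp

lemma slack_n: "slack k n = gap k E V"
  using slack_eq[of n k] by (simp add: S_n)

text \<open>Inclusion and exclusion over ordered pairs of distinct vertices: the indicators of the
  two arcs sum to 1 plus the indicator of both minus that of neither.\<close>

lemma mutual_arcs:
  "cnt (\<lambda>x y. E x y \<and> E y x) V V = 2 * cnt E V V - int n * (int n - 1) + cnt (nonadj E) V V"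
proof -
  have ne: "cnt (\<lambda>x y. x \<noteq> y) V V = int n * (int n - 1)"
  proof -
    have "cnt (\<lambda>x y. x \<noteq> y) V V = (\<Sum>x\<in>V. \<Sum>y\<in>V. 1 - of_bool (y = x))"
      unfolding cnt_def by (intro sum.cong) auto
    also have "\<dots> = (\<Sum>x\<in>V. int (card V) - 1)"
      using fin by (intro sum.cong) (auto simp: sum_subtractf of_bool_def)
    finally show ?thesis using card_V by simp
  qed
  have "cnt (\<lambda>x y. E x y \<and> E y x) V V + cnt (\<lambda>x y. x \<noteq> y) V V
      = cnt E V V + cnt (\<lambda>x y. E y x) V V + cnt (nonadj E) V V"
    unfolding cnt_def sum.distrib[symmetric]
  proof (intro sum.cong refl)
    fix x y
    show "of_bool (E x y \<and> E y x) + of_bool (x \<noteq> y)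
        = of_bool (E x y) + of_bool (E y x) + (of_bool (nonadj E x y) :: int)"
      using irr by (cases "x = y"; cases "E x y"; cases "E y x") (auto simp: nonadj_def)
  qed
  then show ?thesis using ne cnt_transpose[of "\<lambda>x y. E y x" E V V] by simp
qed

text \<open>Up to nonadjacent pairs the mutual arcs depend only on the number of arcs, so their
  contribution is linear and becomes \<open>2 * slack k n\<close>. Majorization is left to handle
  only the squares.\<close>

lemma energy_diff:
  "max_energy k n - energy E V
    = (\<Sum>i<n. (max_deg k n i)\<^sup>2 - (d i)\<^sup>2) + 2 * slack k n - cnt (nonadj E) V V"
proof -
  have "energy E V = (\<Sum>i<n. (d i)\<^sup>2) + (2 * cnt E V V - int n * (int n - 1) + cnt (nonadj E) V V)"
    unfolding energy_def mutual_arcs d_def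
    by (subst (1) V_eq) (simp add: sum.reindex[OF inj])
  moreover have "2 * max_arcs k n = int n * (int n - 1) + 2 * (\<Sum>i<n. int (i mod k))"
    by (simp add: max_arcs_def sum.distrib distrib_left sum_lessThan_int)
  ultimately show ?thesis
    by (simp add: max_energy_def sum.distrib sum_subtractf slack_n gap_def card_V sum_distrib_left)
qed

lemma energy_eq_max:
  assumes k: "1 \<le> k"
    and E: "\<And>i j. \<lbrakk>i < n; j < n\<rbrakk> \<Longrightarrow> E (v i) (v j) \<longleftrightarrow> i \<noteq> j \<and> i div k \<le> j div k"
  shows "energy E V = max_energy k n"
proof -
  have d: "d i = max_deg k n i" if "i < n" for i
  proof -
    have "d i = (\<Sum>j<n. of_bool (i \<noteq> j \<and> i div k \<le> j div k))"
      unfolding d_def cnt_def using E that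
      by (subst V_eq) (simp add: sum.reindex[OF inj])
    also have "\<dots> = int (card ({..<n} \<inter> {j. i \<noteq> j \<and> i div k \<le> j div k}))"
      by (simp add: sum_of_bool_eq)
    \<comment> \<open>The out-neighbours of \<open>i\<close> are all vertices from the start of its
      block onwards, except \<open>i\<close> itself.\<close>
    also have "{..<n} \<inter> {j. i \<noteq> j \<and> i div k \<le> j div k} = {i div k * k..<n} - {i}"
      using k by (auto simp: less_eq_div_iff_mult_less_eq)
    also have "card \<dots> = n - i div k * k - 1"
      using that by (subst card_Diff_singleton) auto
    finally have "d i = int (n - i div k * k - 1)" .
    moreover have "int i = int (i div k * k) + int (i mod k)"
      by (metis div_mult_mod_eq of_nat_add)
    moreover have "i div k * k \<le> i" by simp
    ultimately show ?thesis using that unfolding max_deg_def by linarith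
  qed
  have "slack k n = 0" using d by (simp add: slack_def)
  moreover have "cnt (nonadj E) V V = 0"
    using fin E by (subst cnt_eq_0_iff) (auto simp: V_eq nonadj_def not_le)
  moreover have "(\<Sum>i<n. (max_deg k n i)\<^sup>2 - (d i)\<^sup>2) = 0" using d by simp
  ultimately show ?thesis using energy_diff[of k] by simp
qed

end

section \<open>Upper bound on the energy from decreasing outdegrees\<close>

locale ranked_cycle_free_digraph = enumerated_digraph +
  fixes k q r :: nat
  assumes k3: "3 \<le> k" and n_eq: "n = q * k + r" and r: "1 \<le> r" "r \<le> k"
    and free: "cycle_free E V (Suc k)"
    and sorted: "\<And>i j. \<lbrakk>i \<le> j; j < n\<rbrakk> \<Longrightarrow> d j \<le> d i"
begin

lemma k1: "1 \<le> k" using k3 by simp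

lemma free_S: "j \<le> n \<Longrightarrow> cycle_free E (S j) (Suc k)"
  using cycle_free_subset[OF free] S_subset by blast

lemma gap_S_nonneg: "j \<le> n \<Longrightarrow> 0 \<le> gap k E (S j)"
  by (rule gap_nonneg[where E = E, OF finite_S k1 irr free_S])

lemma slack_nonneg: "j \<le> n \<Longrightarrow> 0 \<le> slack k j"
  using slack_ge[of j k] gap_S_nonneg[of j] cnt_nonneg[of "nonadj E" "S j" "V - S j"] by linarith

lemma mult_le_n: "J \<le> q \<Longrightarrow> J * k \<le> n"
  unfolding n_eq using mult_le_mono1[of J q k] by linarith

lemma sum_squares_ge:
  "int k * (\<Sum>J<q. slack k (Suc J * k)) + (int r - 1) * slack k n
    \<le> (\<Sum>i<n. (max_deg k n i)\<^sup>2 - (d i)\<^sup>2)"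
proof -
  define m where "m = n - 1"
  have n: "n = Suc m" using n_eq r by (simp add: m_def)
  have m: "m = q * k + (r - 1)" using n_eq r by (simp add: m_def)
  define g where "g i = max_deg k n i + d i" for i
  have "(\<Sum>i<n. (max_deg k n i)\<^sup>2 - (d i)\<^sup>2) = (\<Sum>i<Suc m. (max_deg k n i - d i) * g i)"
    unfolding n g_def by (intro sum.cong) (auto simp: power2_eq_square algebra_simps)
  also have "\<dots> = (\<Sum>j<m. slack k (Suc j) * (g j - g (Suc j))) + slack k n * g m"
    using abel_summation[of "\<lambda>i. max_deg k n i - d i" g m] by (simp only: slack_def n[symmetric])
  finally have eq: "(\<Sum>i<n. (max_deg k n i)\<^sup>2 - (d i)\<^sup>2)
      = (\<Sum>j<m. slack k (Suc j) * (g j - g (Suc j))) + slack k n * g m" .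
  have "(\<Sum>j<m. if k dvd Suc j then slack k (Suc j) * int k else 0)
      \<le> (\<Sum>j<m. slack k (Suc j) * (g j - g (Suc j)))"
  proof (rule sum_mono)
    fix j assume j: "j \<in> {..<m}"
    then have "(if k dvd Suc j then int k else 0) \<le> g j - g (Suc j)"
      using max_deg_diff[OF k1, of n j] sorted[of j "Suc j"] n unfolding g_def by auto
    then have "slack k (Suc j) * (if k dvd Suc j then int k else 0) \<le> slack k (Suc j) * (g j - g (Suc j))"
      using slack_nonneg[of "Suc j"] j n by (intro mult_left_mono) auto
    then show "(if k dvd Suc j then slack k (Suc j) * int k else 0) \<le> slack k (Suc j) * (g j - g (Suc j))"
      by (cases "k dvd Suc j") simp_all
  qed
  moreover have "(\<Sum>j<m. if k dvd Suc j then slack k (Suc j) * int k else 0)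
      = int k * (\<Sum>J<q. slack k (Suc J * k))"
    unfolding m using r sum_over_multiples[of "r - 1" k "\<lambda>j. slack k j * int k" q]
    by (simp add: sum_distrib_left mult.commute)
  moreover have "(int r - 1) * slack k n \<le> slack k n * g m"
  proof -
    have "m mod k = (r - 1) mod k" unfolding m by (rule mod_mult_self3)
    then have "m mod k = r - 1" using r by simp
    then have "int r - 1 \<le> g m"
      using r by (simp add: g_def max_deg_def n d_def of_nat_diff)
    then show ?thesis using slack_nonneg[of n] by (simp add: mult.commute[of "slack k n"] mult_right_mono)
  qed
  ultimately show ?thesis using eq by linarith
qed

definition block :: "nat \<Rightarrow> 'a set" where "block J = S (Suc J * k) - S (J * k)"

text \<open>A nonadjacent pair in different blocks is charged to the earlier one, in both
  orders.\<close>

definition block_nonadj :: "nat \<Rightarrow> int" where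
  "block_nonadj J = cnt (nonadj E) (block J) (block J)
    + 2 * cnt (nonadj E) (V - S (Suc J * k)) (block J)"

lemma S_mult_mono: "S (J * k) \<subseteq> S (Suc J * k)" by (rule S_mono) simp

lemma card_block: "J < q \<Longrightarrow> card (block J) = k"
  using card_S[of "J * k"] card_S[of "Suc J * k"] mult_le_n[of J] mult_le_n[of "Suc J"] S_mult_mono
  by (simp add: block_def card_Diff_subset del: mult_Suc) simp

lemma nonadj_eq_sum_blocks:
  "J \<le> q \<Longrightarrow> cnt (nonadj E) V V
    = (\<Sum>I<J. block_nonadj I) + cnt (nonadj E) (V - S (J * k)) (V - S (J * k))"
proof (induction J)
  case 0
  then show ?case by (simp add: S_def)
next
  case (Suc J)
  have sub: "block J \<subseteq> V - S (J * k)"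
    using S_subset[OF mult_le_n[OF Suc.prems]] by (auto simp: block_def)
  have "V - S (J * k) - block J = V - S (Suc J * k)"
    using S_mult_mono[of J] by (auto simp: block_def)
  then show ?case
    using Suc cnt_nonadj_split[OF _ sub, of E] fin by (simp add: block_nonadj_def)
qed

text \<open>Pairs inside the block are paid for by the gap of the prefix at the rate
  \<open>k\<close>. Pairs with later vertices cost 2 each, and the missing forward arcs pay at least
  3, as \<open>k \<ge> 3\<close>. Strictness makes equality impossible unless the slack is
  zero.\<close>

lemma block_nonadj_le:
  assumes J: "J < q"
  shows "block_nonadj J \<le> int k * slack k (Suc J * k)"
    and "0 < slack k (Suc J * k) \<Longrightarrow> block_nonadj J < int k * slack k (Suc J * k)"
proof -
  let ?T = "S (Suc J * k)"
  let ?N = "cnt (nonadj E)"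
  have le: "Suc J * k \<le> n" using mult_le_n[of "Suc J"] J by simp
  have s: "gap k E ?T + ?N ?T (V - ?T) \<le> slack k (Suc J * k)" by (rule slack_ge[OF le])
  have g: "0 \<le> gap k E ?T" by (rule gap_S_nonneg[OF le])
  have B: "block J \<subseteq> ?T" by (auto simp: block_def)
  have "?N (V - ?T) (block J) \<le> ?N (V - ?T) ?T" using B fin by (intro cnt_mono) auto
  then have X: "?N (V - ?T) (block J) \<le> ?N ?T (V - ?T)" by (metis cnt_nonadj_sym)
  have 1: "?N (block J) (block J) \<le> int k * gap k E ?T"
    "0 < gap k E ?T \<Longrightarrow> ?N (block J) (block J) < int k * gap k E ?T"
  proof -
    have lt: "?N (block J) (block J) < int k * gap k E ?T" if "0 < ?N (block J) (block J)"
      using nonadj_less_gap[where E = E, OF irr finite_S k3 free_S[OF le] card_S[OF le] B _ that]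
        card_block[OF J] by simp
    have nn: "0 \<le> ?N (block J) (block J)" by simp
    have ge: "0 \<le> int k * gap k E ?T" using g by simp
    show "?N (block J) (block J) \<le> int k * gap k E ?T"
      using lt nn ge by linarith
    assume "0 < gap k E ?T"
    then have "0 < int k * gap k E ?T" using k1 by simp
    then show "?N (block J) (block J) < int k * gap k E ?T" using lt nn by linarith
  qed
  have nn: "0 \<le> ?N ?T (V - ?T)" by simp
  have K: "int k * (gap k E ?T + ?N ?T (V - ?T)) \<le> int k * slack k (Suc J * k)"
    using s by (intro mult_left_mono) auto
  have K3: "3 * ?N ?T (V - ?T) \<le> int k * ?N ?T (V - ?T)"
    using k3 by (intro mult_right_mono) auto
  have K': "int k * gap k E ?T + int k * ?N ?T (V - ?T) \<le> int k * slack k (Suc J * k)"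
    using K by (simp only: distrib_left)
  show "block_nonadj J \<le> int k * slack k (Suc J * k)"
    unfolding block_nonadj_def using X 1(1) nn K3 K' by linarith
  assume pos: "0 < slack k (Suc J * k)"
  have pos': "0 < int k * slack k (Suc J * k)" using pos k1 by simp
  consider "0 < gap k E ?T" | "0 < ?N ?T (V - ?T)" | "gap k E ?T = 0" "?N ?T (V - ?T) = 0"
    using g nn by linarith
  then show "block_nonadj J < int k * slack k (Suc J * k)"
  proof cases
    case 1
    then show ?thesis unfolding block_nonadj_def using X \<open>0 < gap k E ?T \<Longrightarrow> _\<close> nn K3 K' by linarith
  next
    case 2
    then show ?thesis unfolding block_nonadj_def using X 1(1) nn K3 K' by linarith
  next
    case 3
    then have "block_nonadj J \<le> 0" unfolding block_nonadj_def using X 1(1) by simp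
    then show ?thesis using pos' by linarith
  qed
qed

text \<open>For \<open>r < k\<close> this is the remainder bound with \<open>\<rho> = r\<close>. For
  \<open>r = k\<close> the whole vertex set is a multiple of \<open>k\<close>, and the rate
  \<open>k\<close> is below \<open>r + 1\<close>.\<close>

lemma last_block_nonadj_le:
  shows "cnt (nonadj E) (V - S (q * k)) (V - S (q * k)) \<le> (int r + 1) * slack k n"
    and "0 < slack k n \<Longrightarrow>
      cnt (nonadj E) (V - S (q * k)) (V - S (q * k)) < (int r + 1) * slack k n"
proof -
  let ?B = "V - S (q * k)"
  let ?N = "cnt (nonadj E) ?B ?B"
  have sub: "S (q * k) \<subseteq> V" using S_subset mult_le_n[of q] by simp
  have cB: "card ?B = r"
    using sub card_S[of "q * k"] mult_le_n[of q] card_V n_eq by (simp add: card_Diff_subset)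
  have s0: "0 \<le> slack k n" using slack_nonneg by simp
  have lt: "?N < (int r + 1) * slack k n" if pos: "0 < ?N"
  proof (cases "r < k")
    case True
    have cV: "card V = q * k + r" using card_V n_eq by simp
    show ?thesis
      using nonadj_less_gap_remainder[where E = E, OF irr fin k3 free cV r _ _ order_refl True pos] cB
      by (simp add: slack_n)
  next
    case False
    then have cV: "card V = Suc q * k" using card_V n_eq r by simp
    then have "?N < int k * gap k E V"
      using nonadj_less_gap[where E = E, OF irr fin k3 free cV _ _ pos] cB r by simp
    also have "\<dots> \<le> (int r + 1) * slack k n"
      using False r s0 by (simp add: slack_n mult_right_mono)
    finally show ?thesis .
  qed
  have nn: "0 \<le> ?N" by simp
  have ge: "0 \<le> (int r + 1) * slack k n" using s0 by simp
  show "?N \<le> (int r + 1) * slack k n" using lt nn ge by linarith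
  assume "0 < slack k n"
  then have "0 < (int r + 1) * slack k n" by simp
  then show "?N < (int r + 1) * slack k n" using lt nn by linarith
qed

text \<open>The coefficient \<open>r + 1\<close> of \<open>slack k n\<close> consists of
  \<open>r - 1\<close> from the squares and 2 from the mutual arcs.\<close>

lemma energy_diff_ge:
  "(\<Sum>J<q. int k * slack k (Suc J * k) - block_nonadj J)
    + ((int r + 1) * slack k n - cnt (nonadj E) (V - S (q * k)) (V - S (q * k)))
    \<le> max_energy k n - energy E V"
  using sum_squares_ge energy_diff[of k] nonadj_eq_sum_blocks[of q]
  by (simp add: sum_subtractf sum_distrib_left algebra_simps del: mult_Suc)

lemma energy_le: "energy E V \<le> max_energy k n"
proof -
  have "0 \<le> (\<Sum>J<q. int k * slack k (Suc J * k) - block_nonadj J)"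
    using block_nonadj_le(1) by (intro sum_nonneg) (simp del: mult_Suc)
  then show ?thesis using energy_diff_ge last_block_nonadj_le(1) by linarith
qed

text \<open>All terms of \<open>energy_diff_ge\<close> are nonnegative, so equality makes each
  vanish; the strict bounds then leave no positive slack.\<close>

lemma slack_eq_0:
  assumes "energy E V = max_energy k n"
  shows "\<And>J. J \<le> q \<Longrightarrow> slack k (J * k) = 0" and "slack k n = 0"
proof -
  have nn: "0 \<le> int k * slack k (Suc J * k) - block_nonadj J" if "J < q" for J
    using block_nonadj_le(1)[OF that] by linarith
  then have ge: "0 \<le> (\<Sum>J<q. int k * slack k (Suc J * k) - block_nonadj J)"
    by (intro sum_nonneg) (simp del: mult_Suc)
  have z: "(\<Sum>J<q. int k * slack k (Suc J * k) - block_nonadj J) = 0"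
    and last: "(int r + 1) * slack k n \<le> cnt (nonadj E) (V - S (q * k)) (V - S (q * k))"
    using ge energy_diff_ge last_block_nonadj_le(1) assms by linarith+
  show "slack k n = 0"
    using last last_block_nonadj_le(2) slack_nonneg[of n] by fastforce
  show "slack k (J * k) = 0" if "J \<le> q" for J
  proof (cases J)
    case 0
    then show ?thesis by (simp add: slack_def)
  next
    case (Suc I)
    then have I: "I < q" using that by simp
    then have "int k * slack k (Suc I * k) - block_nonadj I = 0"
      using z nn by (subst (asm) sum_nonneg_eq_0_iff) (auto simp del: mult_Suc)
    moreover have "0 \<le> slack k (Suc I * k)" by (rule slack_nonneg[OF mult_le_n]) (use I in simp)
    ultimately show ?thesis using block_nonadj_le(2)[OF I] Suc by (cases "0 < slack k (Suc I * k)") auto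
  qed
qed

end

section \<open>Structure of the digraphs that attain the bound\<close>

context ranked_cycle_free_digraph
begin

lemma gap_S_eq_0:
  assumes "j \<le> n" "slack k j = 0"
  shows "gap k E (S j) = 0" and "cnt E (S j) (V - S j) = int j * (int n - int j)"
  using slack_eq[OF assms(1), of k] cnt_cross[OF assms(1)] gap_S_nonneg[OF assms(1)] assms(2)
    cnt_nonneg[of "nonadj E" "S j" "V - S j"] by linarith+

lemma all_arcs_forward:
  assumes j: "j \<le> n" "slack k j = 0" and xy: "x \<in> S j" "y \<in> V - S j"
  shows "E x y"
proof (rule ccontr)
  assume "\<not> E x y"
  then have "1 \<le> cnt (\<lambda>x y. \<not> E x y) (S j) (V - S j)"
    using cnt_pos[of "S j" "V - S j" x y "\<lambda>x y. \<not> E x y"] xy fin by simp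
  moreover have "cnt E (S j) (V - S j) + cnt (\<lambda>x y. \<not> E x y) (S j) (V - S j) \<le> int j * (int n - int j)"
  proof -
    have "cnt E (S j) (V - S j) + cnt (\<lambda>x y. \<not> E x y) (S j) (V - S j)
        = cnt (\<lambda>x y. True) (S j) (V - S j)"
      unfolding cnt_def sum.distrib[symmetric] by (intro sum.cong) auto
    also have "\<dots> \<le> int (card (S j)) * int (card (V - S j))" by (rule cnt_le_card)
    also have "card (V - S j) = n - j"
      using S_subset[OF j(1)] card_S[OF j(1)] card_V by (simp add: card_Diff_subset)
    finally show ?thesis using card_S[OF j(1)] j(1) by (simp add: of_nat_diff)
  qed
  ultimately show False using gap_S_eq_0(2)[OF j] by linarith
qed

context
  assumes max: "energy E V = max_energy k n"
begin

text \<open>The cut at the start of the block of \<open>v j\<close> separates the two vertices and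
  has slack 0.\<close>

lemma arc_to_later_block:
  assumes ij: "i < n" "j < n" "i div k < j div k"
  shows "E (v i) (v j)"
proof -
  define J where "J = j div k"
  have "J * k \<le> j" by (simp add: J_def)
  then have Jn: "J * k < n" using ij by simp
  have "J \<le> q"
  proof (rule ccontr)
    assume "\<not> J \<le> q"
    then have "Suc q * k \<le> J * k" by (intro mult_le_mono1) simp
    then show False using Jn n_eq r by simp
  qed
  then have s: "slack k (J * k) = 0" by (rule slack_eq_0(1)[OF max])
  have "i < J * k" using ij k1 by (simp add: J_def div_less_iff_less_mult)
  then have "v i \<in> S (J * k)" using v_in_S_iff ij Jn by simp
  moreover have "v j \<in> V - S (J * k)"
    using v_in_S_iff[of j "J * k"] ij Jn \<open>J * k \<le> j\<close> by (auto simp: V_eq)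
  ultimately show ?thesis using all_arcs_forward[OF _ s] Jn by simp
qed

text \<open>Any other vertex \<open>p\<close> of the block has a forward arc to \<open>y\<close>.
  Together with an arc from \<open>y\<close> to \<open>x\<close> this is a bypass of a complete
  block, which would be a cycle of length \<open>Suc k\<close>.\<close>

lemma no_arc_to_complete_block:
  assumes J: "J < q" and complete: "defect E (block J) = 0"
    and y: "y \<in> V - S (Suc J * k)" and x: "x \<in> block J"
  shows "\<not> E y x"
proof
  assume yx: "E y x"
  have le: "Suc J * k \<le> n" using mult_le_n[of "Suc J"] J by simp
  have fB: "finite (block J)" by (simp add: block_def)
  have B: "block J \<subseteq> S (Suc J * k)" by (auto simp: block_def)
  have "1 \<le> card (block J - {x})" using card_block[OF J] x fB k3 by simp
  then obtain p where p: "p \<in> block J" "p \<noteq> x" by (metis DiffD1 DiffD2 One_nat_def Suc_le_eq card_gt_0_iff ex_in_conv singletonI)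
  have py: "E p y"
    using all_arcs_forward[OF le slack_eq_0(1)[OF max]] J p(1) B y by (meson Suc_leI subsetD)
  have "cycle_free E (insert y (block J)) (Suc k)"
    by (rule cycle_free_subset[OF free]) (use y B S_subset[OF le] in auto)
  then have "p = x"
    using almost_complete_no_bypass[where E = E, OF irr fB card_block[OF J] k3 _ _ _ p(1) x py yx]
      complete k3 y B by auto
  then show False using p by simp
qed

lemma max_arcs_add_twice:
  "b \<le> k \<Longrightarrow> 2 * max_arcs k (J * k + b) = 2 * max_arcs k (J * k) + 2 * int (J * k) * int b + 2 * int b * (int b - 1)"
  using max_arcs_twice[of 0 k J] max_arcs_twice[of b k J] unfolding of_nat_add of_nat_mult
  by (simp add: algebra_simps del: of_nat_mult of_nat_add)

text \<open>Both prefixes have the extremal number of arcs. With no arc back and at most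
  \<open>J * k * b\<close> forward, the difference can only be reached if the new block is
  complete.\<close>

lemma defect_block_eq_0:
  assumes le: "J * k + b \<le> n" "b \<le> k" and s: "slack k (J * k + b) = 0" "slack k (J * k) = 0"
    and no_back: "\<And>x y. \<lbrakk>x \<in> S (J * k); y \<in> V - S (J * k)\<rbrakk> \<Longrightarrow> \<not> E y x"
  shows "defect E (S (J * k + b) - S (J * k)) = 0"
proof -
  let ?T = "S (J * k + b)" and ?U = "S (J * k)"
  have UT: "?U \<subseteq> ?T" by (rule S_mono) simp
  have cards: "card ?T = J * k + b" "card ?U = J * k" using card_S le by simp_all
  have cB: "card (?T - ?U) = b" using UT cards by (simp add: card_Diff_subset)
  have gT: "cnt E ?T ?T = max_arcs k (J * k + b)" using gap_S_eq_0(1)[OF le(1) s(1)] cards by (simp add: gap_def)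
  have gU: "cnt E ?U ?U = max_arcs k (J * k)" using gap_S_eq_0(1)[OF _ s(2)] le cards by (simp add: gap_def)
  have TV: "?T \<subseteq> V" by (rule S_subset[OF le(1)])
  have b1: "cnt E (?T - ?U) ?U = 0" using no_back TV by (subst cnt_eq_0_iff) auto
  have f1: "cnt E ?U (?T - ?U) \<le> int (J * k) * int b" using cnt_le_card[of E ?U "?T - ?U"] cards cB by simp
  have "2 * cnt E (?T - ?U) (?T - ?U) \<ge> 2 * (int b * (int b - 1))"
    using cnt_split[OF finite_S UT, of E] gT gU b1 f1 max_arcs_add_twice[OF le(2), of J] by simp
  then show ?thesis
    using defect_nonneg[where E = E, of "?T - ?U", OF _ irr] cB by (simp add: defect_def)
qed

text \<open>The induction alternates: no arcs back into a prefix make the next block complete, and a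
  complete block receives no arc from later vertices.\<close>

lemma no_arc_back:
  "J \<le> q \<Longrightarrow> x \<in> S (J * k) \<Longrightarrow> y \<in> V - S (J * k) \<Longrightarrow> \<not> E y x"
proof (induction J arbitrary: x y)
  case 0
  then show ?case by (simp add: S_def)
next
  case (Suc J)
  have J: "J < q" using Suc.prems by simp
  have "defect E (S (J * k + k) - S (J * k)) = 0"
  proof (rule defect_block_eq_0)
    show "J * k + k \<le> n" using mult_le_n[of "Suc J"] J by simp
    show "slack k (J * k + k) = 0" using slack_eq_0(1)[OF max, of "Suc J"] J by (simp add: add.commute)
    show "slack k (J * k) = 0" using slack_eq_0(1)[OF max, of J] J by simp
  qed (use Suc.IH J in auto)
  then have c: "defect E (block J) = 0" by (simp add: block_def add.commute)
  show ?case
  proof (cases "x \<in> block J")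
    case True
    then show ?thesis using no_arc_to_complete_block[OF J c Suc.prems(3)] by simp
  next
    case False
    then have "x \<in> S (J * k)" using Suc.prems by (simp add: block_def)
    moreover have "y \<in> V - S (J * k)" using Suc.prems S_mult_mono[of J] by auto
    ultimately show ?thesis using Suc.IH J by simp
  qed
qed

lemma arcs_of_maximizer:
  assumes ij: "i < n" "j < n"
  shows "E (v i) (v j) \<longleftrightarrow> i \<noteq> j \<and> i div k \<le> j div k"
proof -
  have div_le: "a div k \<le> q" if "a < n" for a
  proof (rule ccontr)
    assume "\<not> a div k \<le> q"
    then have "Suc q * k \<le> a div k * k" by (intro mult_le_mono1) simp
    then show False using that n_eq r div_times_less_eq_dividend[of a k] by simp
  qed
  consider "i div k < j div k" | "j div k < i div k" | "i div k = j div k" by linarith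
  then show ?thesis
  proof cases
    case 1
    then show ?thesis using arc_to_later_block[OF ij] by auto
  next
    case 2
    let ?J = "i div k"
    have Jn: "?J * k \<le> n" using mult_le_n div_le[OF ij(1)] by simp
    have "j < ?J * k" using 2 k1 by (simp add: div_less_iff_less_mult)
    then have "v j \<in> S (?J * k)" "v i \<in> V - S (?J * k)"
      using v_in_S_iff[of j "?J * k"] v_in_S_iff[of i "?J * k"] Jn ij(1,2)
        div_times_less_eq_dividend[of i k] by (simp_all add: V_eq not_less)
    then show ?thesis using no_arc_back[OF div_le[OF ij(1)]] 2 by simp
  next
    case 3
    define J where "J = i div k"
    \<comment> \<open>The size of block \<open>J\<close>, which may be the incomplete last one. It
      ends at a multiple of \<open>k\<close> or at \<open>n\<close>, and the slack vanishes at
      both.\<close>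
    define b where "b = min k (n - J * k)"
    have JJ: "J * k \<le> i" "J * k \<le> j" by (simp add: J_def, simp add: J_def 3)
    have JJ': "i < J * k + k" "j < J * k + k"
      using dividend_less_div_times[of k i] dividend_less_div_times[of k j] k1 3
      by (simp_all add: J_def add.commute)
    have J: "J \<le> q" using div_le ij by (simp add: J_def)
    have le: "J * k + b \<le> n" "b \<le> k" using mult_le_n[OF J] by (auto simp: b_def)
    have "J * k + b = Suc J * k \<and> Suc J \<le> q \<or> J * k + b = n"
    proof (cases "Suc J \<le> q")
      case True
      then have "Suc J * k \<le> n" by (rule mult_le_n)
      then show ?thesis using True by (auto simp: b_def min_def)
    next
      case False
      then have "J = q" using J by simp
      then show ?thesis using n_eq r by (simp add: b_def)
    qed
    then have "slack k (J * k + b) = 0"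
      using slack_eq_0(1)[OF max, of "Suc J"] slack_eq_0(2)[OF max] by metis
    then have "defect E (S (J * k + b) - S (J * k)) = 0"
      using le slack_eq_0(1)[OF max J] no_arc_back[OF J] by (intro defect_block_eq_0)
    then have "\<forall>x\<in>S (J * k + b) - S (J * k). \<forall>y\<in>S (J * k + b) - S (J * k). x \<noteq> y \<longrightarrow> E x y"
      by (subst (asm) defect_eq_0_iff[where E = E, OF _ irr]) simp_all
    moreover have "v i \<in> S (J * k + b) - S (J * k)" "v j \<in> S (J * k + b) - S (J * k)"
      using v_in_S_iff[of i "J * k"] v_in_S_iff[of i "J * k + b"] v_in_S_iff[of j "J * k"]
        v_in_S_iff[of j "J * k + b"] le ij JJ JJ' by (simp_all add: b_def min_def)
    moreover have "v i = v j \<longleftrightarrow> i = j" using inj_on_eq_iff[OF inj] ij by simp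
    ultimately show ?thesis using 3 irr by (metis order_refl)
  qed
qed

end

end

section \<open>The bound and its equality case without a fixed enumeration\<close>

lemma sorted_enumeration:
  fixes f :: "'a \<Rightarrow> int"
  assumes "finite V"
  obtains v where "bij_betw v {..<card V} V" "\<And>i j. \<lbrakk>i \<le> j; j < card V\<rbrakk> \<Longrightarrow> f (v j) \<le> f (v i)"
proof -
  obtain ys where ys: "set ys = V" "distinct ys" using finite_distinct_list[OF assms] by auto
  define xs where "xs = sort_key (\<lambda>x. - f x) ys"
  have xs: "set xs = V" "distinct xs" "length xs = card V" "sorted (map (\<lambda>x. - f x) xs)"
    using ys by (auto simp: xs_def distinct_card)
  have "bij_betw (\<lambda>i. xs ! i) {..<card V} V"
    by (rule bij_betw_nth[OF xs(2)]) (simp_all only: xs(1,3))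
  moreover have "f (xs ! j) \<le> f (xs ! i)" if "i \<le> j" "j < card V" for i j
  proof -
    have "map (\<lambda>x. - f x) xs ! i \<le> map (\<lambda>x. - f x) xs ! j"
      by (rule sorted_nth_mono[OF xs(4) that(1)]) (simp only: length_map xs(3) that(2))
    then show ?thesis using that by (simp add: xs(3))
  qed
  ultimately show ?thesis by (rule that)
qed

theorem energy_cycle_free:
  assumes irr: "\<And>x. \<not> E x x" and fin: "finite V" and k: "3 \<le> k" and free: "cycle_free E V (Suc k)"
    and n: "card V = n" "1 \<le> n"
  shows "energy E V \<le> max_energy k n"
    and "energy E V = max_energy k n \<longleftrightarrow> (\<exists>v. bij_betw v {..<n} V \<and>
      (\<forall>i<n. \<forall>j<n. E (v i) (v j) \<longleftrightarrow> i \<noteq> j \<and> i div k \<le> j div k))"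
proof -
  obtain v where v: "bij_betw v {..<n} V"
    and sorted: "\<And>i j. \<lbrakk>i \<le> j; j < n\<rbrakk> \<Longrightarrow> cnt E {v j} V \<le> cnt E {v i} V"
    using sorted_enumeration[OF fin, of "\<lambda>u. cnt E {u} V"] n by metis
  obtain q r where qr: "n = q * k + r" "1 \<le> r" "r \<le> k"
    using card_eq_residue[of k n] k n by auto
  interpret enumerated_digraph E V n v by unfold_locales (use irr v in auto)
  interpret ranked_cycle_free_digraph E V n v k q r
    by unfold_locales (use k qr free sorted in \<open>auto simp: d_def\<close>)
  show "energy E V \<le> max_energy k n" by (rule energy_le)
  show "energy E V = max_energy k n \<longleftrightarrow> (\<exists>v. bij_betw v {..<n} V \<and>
      (\<forall>i<n. \<forall>j<n. E (v i) (v j) \<longleftrightarrow> i \<noteq> j \<and> i div k \<le> j div k))"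
  proof
    assume "energy E V = max_energy k n"
    then show "\<exists>v. bij_betw v {..<n} V \<and>
      (\<forall>i<n. \<forall>j<n. E (v i) (v j) \<longleftrightarrow> i \<noteq> j \<and> i div k \<le> j div k)"
      using arcs_of_maximizer v by blast
  next
    assume "\<exists>v. bij_betw v {..<n} V \<and>
      (\<forall>i<n. \<forall>j<n. E (v i) (v j) \<longleftrightarrow> i \<noteq> j \<and> i div k \<le> j div k)"
    then obtain w where w: "bij_betw w {..<n} V"
      "\<forall>i<n. \<forall>j<n. E (w i) (w j) \<longleftrightarrow> i \<noteq> j \<and> i div k \<le> j div k" by blast
    \<comment> \<open>The enumeration given by the block structure is used as it stands, in the
      locale that imposes no order by outdegree.\<close>
    interpret w: enumerated_digraph E V n w by unfold_locales (use irr w in auto)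
    show "energy E V = max_energy k n" using w.energy_eq_max[OF k1] w(2) by blast
  qed
qed

section \<open>Eigenvalues and traces\<close>

text \<open>The trace of \<open>A * A\<close>, written entrywise so that the entries of the
  Laplacian can be inserted directly.\<close>

definition trace_sq :: "complex mat \<Rightarrow> complex" where
  "trace_sq A = (\<Sum>i<dim_row A. \<Sum>j<dim_row A. A $$ (i, j) * A $$ (j, i))"

lemma trace_mult_comm:
  fixes A B :: "complex mat"
  assumes "A \<in> carrier_mat n n" "B \<in> carrier_mat n n"
  shows "(\<Sum>i<n. (A * B) $$ (i, i)) = (\<Sum>i<n. (B * A) $$ (i, i))"
proof -
  have *: "(\<Sum>i<n. (A * B) $$ (i, i)) = (\<Sum>i<n. \<Sum>j<n. A $$ (i, j) * B $$ (j, i))"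
    if "A \<in> carrier_mat n n" "B \<in> carrier_mat n n" for A B :: "complex mat"
    using that by (intro sum.cong) (auto simp: scalar_prod_def lessThan_atLeast0)
  show ?thesis unfolding *[OF assms] *[OF assms(2,1)]
    by (subst sum.swap) (simp add: mult.commute)
qed

lemma trace_sq_eq:
  assumes "A \<in> carrier_mat n n"
  shows "trace_sq A = (\<Sum>i<n. (A * A) $$ (i, i))"
  using assms unfolding trace_sq_def
  by (auto intro!: sum.cong simp: scalar_prod_def lessThan_atLeast0)

text \<open>\<open>A * A\<close> equals \<open>P * (B * B * Q)\<close>, and the trace is invariant
  under cyclic exchange of factors.\<close>

lemma trace_sq_similar:
  assumes "similar_mat A B"
  shows "trace_sq A = trace_sq B"
proof -
  obtain n P Q where *: "{A, B, P, Q} \<subseteq> carrier_mat n n" "Q * P = 1\<^sub>m n" "A = P * B * Q"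
    using similar_matD[OF assms] by blast
  then have c: "A \<in> carrier_mat n n" "B \<in> carrier_mat n n" "P \<in> carrier_mat n n" "Q \<in> carrier_mat n n"
    by auto
  have "A * A = P * B * (Q * P) * (B * Q)"
    unfolding *(3) using c by (simp add: assoc_mult_mat[of _ n n _ n _ n] mult_carrier_mat[of _ n n _ n])
  also have "\<dots> = P * (B * B * Q)"
    unfolding *(2) using c by (simp add: assoc_mult_mat[of _ n n _ n _ n] mult_carrier_mat[of _ n n _ n])
  finally have AA: "A * A = P * (B * B * Q)" .
  have "(B * B * Q) * P = B * B * (Q * P)"
    using c by (simp add: assoc_mult_mat[of _ n n _ n _ n] mult_carrier_mat[of _ n n _ n])
  then have BB: "(B * B * Q) * P = B * B" unfolding *(2) using c by (simp add: mult_carrier_mat[of _ n n _ n])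
  have "B * B * Q \<in> carrier_mat n n" using c by (simp add: mult_carrier_mat[of _ n n _ n])
  from trace_mult_comm[OF c(3) this] show ?thesis
    unfolding trace_sq_eq[OF c(1)] trace_sq_eq[OF c(2)] AA BB by simp
qed

text \<open>Schur's theorem gives a similar upper triangular matrix. Its diagonal lists the
  eigenvalues, and off the diagonal one factor of \<open>B $$ (i, j) * B $$ (j, i)\<close> is
  0.\<close>

lemma sum_eigenvalues_squared:
  assumes A: "A \<in> carrier_mat n n"
  shows "(\<Sum>z\<in>#proots (char_poly A). z\<^sup>2) = trace_sq A"
proof -
  obtain es where es: "char_poly A = (\<Prod>a\<leftarrow>es. [:- a, 1:])"
    using char_poly_factorized[OF A] by blast
  obtain B where B: "B \<in> carrier_mat n n" "upper_triangular B" "similar_mat A B"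
    using schur_decomposition_exists[OF A es] by blast
  have "char_poly A = (\<Prod>a\<leftarrow>diag_mat B. [:- a, 1:])"
    using char_poly_similar[OF B(3)] char_poly_upper_triangular[OF B(1,2)] by simp
  then have "proots (char_poly A) = mset (diag_mat B)" by (rule proots_cnj(1))
  then have "(\<Sum>z\<in>#proots (char_poly A). z\<^sup>2) = (\<Sum>i<n. (B $$ (i, i))\<^sup>2)"
    using B(1) by (simp add: diag_mat_def sum_mset_sum_list sum_list_sum_nth atLeast0LessThan flip: mset_map)
  also have "\<dots> = trace_sq B"
  proof -
    have "B $$ (i, j) * B $$ (j, i) = (if j = i then (B $$ (i, i))\<^sup>2 else 0)" if "i < n" "j < n" for i j
      using B(1,2) that by (cases i j rule: linorder_cases) (auto simp: power2_eq_square upper_triangular_def)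
    then show ?thesis unfolding trace_sq_def using B(1) by (auto intro!: sum.cong)
  qed
  also have "\<dots> = trace_sq A" using trace_sq_similar[OF B(3)] by simp
  finally show ?thesis .
qed

section \<open>Translation to the digraph library\<close>

abbreviation arc_rel :: "('a,'b) pre_digraph \<Rightarrow> 'a \<Rightarrow> 'a \<Rightarrow> bool" where
  "arc_rel G x y \<equiv> (x, y) \<in> arcs_ends G"

lemma (in loopfree_digraph) arc_rel_irrefl: "\<not> arc_rel G x x"
  using no_loops by (auto simp: arcs_ends_conv)

lemma (in digraph) out_degree_eq_cnt:
  "int (out_degree G u) = cnt (arc_rel G) {u} (verts G)"
proof -
  have "cnt (arc_rel G) {u} (verts G) = int (card {y \<in> verts G. arc_rel G u y})"
    by (simp add: cnt_def sum_of_bool_eq Int_def)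
  also have "{y \<in> verts G. arc_rel G u y} = head G ` out_arcs G u"
    by (auto simp: arcs_ends_conv out_arcs_def)
  also have "card (head G ` out_arcs G u) = card (out_arcs G u)"
    by (intro card_image inj_onI) (auto simp: out_arcs_def arc_to_ends_def intro!: no_multi_arcs)
  finally show ?thesis by (simp add: out_degree_def)
qed

lemma (in digraph) laplacian_energy_eq_energy:
  "laplacian_energy G = real_of_int (energy (arc_rel G) (verts G))"
proof -
  define vs where "vs = vertex_enum G"
  define L where "L = laplacian_mat G vs"
  define m where "m = length vs"
  have "\<exists>vs. distinct vs \<and> set vs = verts G" using finite_distinct_list[of "verts G"] by auto
  then have "distinct vs \<and> set vs = verts G" unfolding vs_def vertex_enum_def by (rule someI_ex)
  then have vs: "distinct vs" "set vs = verts G" by auto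
  have bij: "bij_betw (\<lambda>i. vs ! i) {..<m} (verts G)"
    by (rule bij_betw_nth[OF vs(1)]) (simp_all add: m_def vs(2))
  have L: "L \<in> carrier_mat m m" "dim_row L = m" by (auto simp: L_def m_def dim_laplacian_mat)
  let ?E = "arc_rel G"
  let ?d = "\<lambda>u. complex_of_int (cnt ?E {u} (verts G))"
  let ?b = "\<lambda>u w. complex_of_int (of_bool (?E u w \<and> ?E w u))"
  have deg: "of_nat (out_degree G u) = ?d u" for u
    using out_degree_eq_cnt[of u] by (metis of_int_of_nat_eq)
  \<comment> \<open>Without loops the diagonal holds the outdegrees; off the diagonal the two minus
    signs cancel and a mutual pair of arcs remains.\<close>
  have ent: "L $$ (i, j) * L $$ (j, i)
      = (if i = j then (?d (vs ! i))\<^sup>2 else 0) + ?b (vs ! i) (vs ! j)" if "i < m" "j < m" for i j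
    using that arc_rel_irrefl
    by (auto simp: L_def m_def laplacian_mat_def adjacency_mat_def outdegree_mat_def deg power2_eq_square)
  have "complex_of_real (laplacian_energy G) = trace_sq L"
    unfolding of_real_laplacian_energy laplacian_eigenvalues_def L_def vs_def
    by (rule sum_eigenvalues_squared[OF L(1)[unfolded L_def vs_def]])
  also have "\<dots> = (\<Sum>i<m. \<Sum>j<m. (if i = j then (?d (vs ! i))\<^sup>2 else 0) + ?b (vs ! i) (vs ! j))"
    unfolding trace_sq_def L(2) by (intro sum.cong refl ent) auto
  also have "\<dots> = (\<Sum>i<m. (?d (vs ! i))\<^sup>2) + (\<Sum>i<m. \<Sum>j<m. ?b (vs ! i) (vs ! j))"
    by (simp add: sum.distrib)
  also have "(\<Sum>i<m. (?d (vs ! i))\<^sup>2) = (\<Sum>u\<in>verts G. (?d u)\<^sup>2)"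
    by (rule sum.reindex_bij_betw[OF bij])
  also have "(\<Sum>i<m. \<Sum>j<m. ?b (vs ! i) (vs ! j)) = (\<Sum>i<m. \<Sum>w\<in>verts G. ?b (vs ! i) w)"
    by (intro sum.cong refl sum.reindex_bij_betw[OF bij])
  also have "\<dots> = (\<Sum>u\<in>verts G. \<Sum>w\<in>verts G. ?b u w)"
    by (rule sum.reindex_bij_betw[OF bij])
  finally have "complex_of_real (laplacian_energy G) = complex_of_int (energy ?E (verts G))"
    by (simp add: energy_def cnt_def)
  also have "\<dots> = complex_of_real (real_of_int (energy ?E (verts G)))" by simp
  finally show ?thesis by (simp only: of_real_eq_iff)
qed

text \<open>A copy of the dicycle is an injective vertex map that respects consecutive arcs. For
  \<open>m \<ge> 2\<close> the convention about single vertices does not interfere.\<close>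

lemma (in digraph) is_free_of_dicycle_iff:
  assumes m: "2 \<le> m"
  shows "is_free_of G (dicycle m) \<longleftrightarrow> cycle_free (arc_rel G) (verts G) m"
proof -
  let ?C = "dicycle m"
  have C: "verts ?C = {..<m}" "arcs ?C = {(i, Suc i mod m) | i. i < m}" "tail ?C = fst" "head ?C = snd"
    by (simp_all add: dicycle_def)
  have wfC: "wf_digraph ?C" using m by unfold_locales (auto simp: C)
  have "(\<exists>H. subgraph H G \<and> digraph_iso ?C H) \<longleftrightarrow> (\<exists>c. dcyc (arc_rel G) c m \<and> c ` {..<m} \<subseteq> verts G)"
  proof
    assume "\<exists>H. subgraph H G \<and> digraph_iso ?C H"
    then obtain H f where H: "subgraph H G" and f: "pre_digraph.digraph_isomorphism ?C f" "H = app_iso f ?C"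
      by (auto simp: digraph_iso_def)
    have vH: "verts H \<subseteq> verts G" "arcs H \<subseteq> arcs G" "tail G = tail H" "head G = head H"
      using H by (auto simp: subgraph_def compatible_def)
    have inj: "inj_on (iso_verts f) {..<m}"
      using f(1) by (simp add: pre_digraph.digraph_isomorphism_def C)
    moreover have "arc_rel G (iso_verts f i) (iso_verts f (Suc i mod m))" if "i < m" for i
    proof -
      let ?a = "(i, Suc i mod m)"
      have a: "?a \<in> arcs ?C" using that by (auto simp: C)
      then have "iso_arcs f ?a \<in> arcs G" using vH f(2) by auto
      moreover have "iso_verts f (tail ?C ?a) = iso_tail f (iso_arcs f ?a) \<and>
          iso_verts f (head ?C ?a) = iso_head f (iso_arcs f ?a)"
        using f(1) a unfolding pre_digraph.digraph_isomorphism_def by blast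
      then have "tail G (iso_arcs f ?a) = iso_verts f i"
        "head G (iso_arcs f ?a) = iso_verts f (Suc i mod m)"
        using vH(3,4) f(2) by (simp_all add: C(3,4))
      moreover note this
      ultimately show ?thesis by (force simp: arcs_ends_conv)
    qed
    moreover have "iso_verts f ` {..<m} \<subseteq> verts G" using vH f(2) by (simp add: C)
    ultimately show "\<exists>c. dcyc (arc_rel G) c m \<and> c ` {..<m} \<subseteq> verts G"
      by (auto simp: dcyc_def)
  next
    assume "\<exists>c. dcyc (arc_rel G) c m \<and> c ` {..<m} \<subseteq> verts G"
    then obtain c where c: "dcyc (arc_rel G) c m" "c ` {..<m} \<subseteq> verts G" by blast
    have inj: "inj_on c {..<m}" using c by (simp add: dcyc_def)
    have "\<forall>i. \<exists>e. i < m \<longrightarrow> e \<in> arcs G \<and> tail G e = c i \<and> head G e = c (Suc i mod m)"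
    proof
      fix i
      show "\<exists>e. i < m \<longrightarrow> e \<in> arcs G \<and> tail G e = c i \<and> head G e = c (Suc i mod m)"
      proof (cases "i < m")
        case True
        then have "arc_rel G (c i) (c (Suc i mod m))" using c(1) m by (auto simp: dcyc_def)
        then show ?thesis by (auto simp: arcs_ends_conv)
      qed simp
    qed
    then obtain e where e: "\<And>i. i < m \<Longrightarrow> e i \<in> arcs G \<and> tail G (e i) = c i \<and> head G (e i) = c (Suc i mod m)"
      by metis
    \<comment> \<open>An arc of the dicycle is determined by its tail, so \<open>fst\<close> selects
      the arc of \<open>G\<close> chosen for it.\<close>
    define f where "f = \<lparr>iso_verts = c, iso_arcs = (\<lambda>a :: nat \<times> nat. e (fst a)), iso_head = head G, iso_tail = tail G\<rparr>"
    have iso: "pre_digraph.digraph_isomorphism ?C f"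
      unfolding pre_digraph.digraph_isomorphism_def
    proof (intro conjI ballI wfC)
      show "inj_on (iso_verts f) (verts ?C)" using inj by (simp add: f_def C)
      show "inj_on (iso_arcs f) (arcs ?C)"
      proof (rule inj_onI)
        fix a b assume "a \<in> arcs ?C" "b \<in> arcs ?C" and eq: "iso_arcs f a = iso_arcs f b"
        then obtain i j where ij: "i < m" "j < m" "a = (i, Suc i mod m)" "b = (j, Suc j mod m)"
          by (auto simp: C)
        then have "c i = c j" using eq e[of i] e[of j] by (simp add: f_def)
        then show "a = b" using ij inj by (auto dest: inj_onD)
      qed
    qed (use e in \<open>auto simp: f_def C\<close>)
    have wf: "wf_digraph (app_iso f ?C)"
      by (rule wf_digraph.wf_digraphI_app_iso[OF wfC iso])
    have "subgraph (app_iso f ?C) G"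
      unfolding subgraph_def compatible_def
      using wf wf_digraph c(2) e by (auto simp: f_def C)
    then show "\<exists>H. subgraph H G \<and> digraph_iso ?C H" using iso by (auto simp: digraph_iso_def)
  qed
  then show ?thesis by (simp add: is_free_of_def cycle_free_def)
qed

text \<open>In the target an arc is the pair of its ends, so the vertex map dictates the arc map;
  this is injective because \<open>G\<close> has no multiple arcs.\<close>

lemma (in digraph) digraph_iso_with_proj_iff:
  assumes R: "R \<subseteq> W \<times> W"
  shows "digraph_iso G (with_proj \<lparr>pverts = W, parcs = R\<rparr>) \<longleftrightarrow>
    (\<exists>f. bij_betw f (verts G) W \<and> (\<forall>x\<in>verts G. \<forall>y\<in>verts G. arc_rel G x y \<longleftrightarrow> (f x, f y) \<in> R))"
    (is "digraph_iso G ?H \<longleftrightarrow> _")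
proof
  assume "digraph_iso G ?H"
  then obtain g where g: "digraph_isomorphism g" "?H = app_iso g G" by (auto simp: digraph_iso_def)
  let ?f = "iso_verts g"
  have H: "W = ?f ` verts G" "R = iso_arcs g ` arcs G" "iso_tail g = fst" "iso_head g = snd"
    using arg_cong[OF g(2), of verts] arg_cong[OF g(2), of arcs] arg_cong[OF g(2), of tail]
      arg_cong[OF g(2), of head] by simp_all
  have inj: "inj_on ?f (verts G)" by (rule digraph_isomorphism_inj_on_verts[OF g(1)])
  have arc: "iso_arcs g a = (?f (tail G a), ?f (head G a))" if "a \<in> arcs G" for a
    using iso_verts_tail[OF g(1) that] iso_verts_head[OF g(1) that] H by (metis prod.collapse)
  have "arc_rel G x y \<longleftrightarrow> (?f x, ?f y) \<in> R" if "x \<in> verts G" "y \<in> verts G" for x y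
  proof
    assume "arc_rel G x y"
    then show "(?f x, ?f y) \<in> R" unfolding H(2) using arc by (force simp: arcs_ends_conv)
  next
    assume "(?f x, ?f y) \<in> R"
    then obtain a where a: "a \<in> arcs G" "(?f x, ?f y) = iso_arcs g a" by (auto simp: H(2))
    then have "tail G a = x" "head G a = y"
      using arc[OF a(1)] inj that by (auto dest: inj_onD)
    then show "arc_rel G x y" using a by (auto simp: arcs_ends_conv)
  qed
  then show "\<exists>f. bij_betw f (verts G) W \<and> (\<forall>x\<in>verts G. \<forall>y\<in>verts G. arc_rel G x y \<longleftrightarrow> (f x, f y) \<in> R)"
    using inj H(1) by (auto simp: bij_betw_def)
next
  assume "\<exists>f. bij_betw f (verts G) W \<and> (\<forall>x\<in>verts G. \<forall>y\<in>verts G. arc_rel G x y \<longleftrightarrow> (f x, f y) \<in> R)"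
  then obtain f where f: "bij_betw f (verts G) W"
    "\<And>x y. \<lbrakk>x \<in> verts G; y \<in> verts G\<rbrakk> \<Longrightarrow> arc_rel G x y \<longleftrightarrow> (f x, f y) \<in> R" by blast
  have inj: "inj_on f (verts G)" and im: "f ` verts G = W" using f(1) by (auto simp: bij_betw_def)
  define g where "g = \<lparr>iso_verts = f, iso_arcs = (\<lambda>a. (f (tail G a), f (head G a))),
    iso_head = snd, iso_tail = fst\<rparr>"
  have iso: "digraph_isomorphism g"
    unfolding digraph_isomorphism_def
  proof (intro conjI ballI wf_digraph)
    show "inj_on (iso_verts g) (verts G)" using inj by (simp add: g_def)
    show "inj_on (iso_arcs g) (arcs G)"
    proof (rule inj_onI)
      fix a b assume ab: "a \<in> arcs G" "b \<in> arcs G" "iso_arcs g a = iso_arcs g b"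
      then have "tail G a = tail G b" "head G a = head G b"
        using inj by (auto simp: g_def dest: inj_onD)
      then show "a = b" using ab by (intro no_multi_arcs) (auto simp: arc_to_ends_def)
    qed
  qed (auto simp: g_def)
  have "R = (\<lambda>a. (f (tail G a), f (head G a))) ` arcs G"
  proof
    show "R \<subseteq> (\<lambda>a. (f (tail G a), f (head G a))) ` arcs G"
    proof
      fix p assume p: "p \<in> R"
      then have "p \<in> f ` verts G \<times> f ` verts G" using R im by auto
      then obtain x y where xy: "x \<in> verts G" "y \<in> verts G" "p = (f x, f y)" by auto
      then have "arc_rel G x y" using f(2) p by simp
      then show "p \<in> (\<lambda>a. (f (tail G a), f (head G a))) ` arcs G" using xy by (auto simp: arcs_ends_conv)
    qed
    show "(\<lambda>a. (f (tail G a), f (head G a))) ` arcs G \<subseteq> R"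
    proof
      fix p assume "p \<in> (\<lambda>a. (f (tail G a), f (head G a))) ` arcs G"
      then obtain a where a: "a \<in> arcs G" "p = (f (tail G a), f (head G a))" by auto
      then have "arc_rel G (tail G a) (head G a)" by (auto simp: arcs_ends_conv)
      then show "p \<in> R" using f(2) a by simp
    qed
  qed
  then have "?H = app_iso g G"
    using im by (simp add: app_iso_def with_proj_def g_def)
  then show "digraph_iso G ?H" using iso by (auto simp: digraph_iso_def)
qed

section \<open>Closed form of the maximal energy\<close>

lemma max_energy_add_block: "1 \<le> k \<Longrightarrow> max_energy k (n + k)
    = max_energy k n + int k * (int n + int k - 1)\<^sup>2 + int k * (int k - 1)"
proof -
  assume k: "1 \<le> k"
  let ?f = "\<lambda>n i. (max_deg k n i)\<^sup>2 + 2 * int (i mod k)"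
  have "(\<Sum>i<n + k. g i) = (\<Sum>i<k. g i) + (\<Sum>i<n. g (i + k))" for g :: "nat \<Rightarrow> int" and n
    by (induction n) simp_all
  then have "max_energy k (n + k) = (\<Sum>i<k. ?f (n + k) i) + (\<Sum>i<n. ?f (n + k) (i + k))"
    unfolding max_energy_def .
  \<comment> \<open>The first block, whose vertices dominate all others, is peeled off; shifting the
    remaining indices by \<open>k\<close> leaves their degrees unchanged.\<close>
  also have "(\<Sum>i<n. ?f (n + k) (i + k)) = max_energy k n"
    unfolding max_energy_def by (intro sum.cong) (auto simp: max_deg_def)
  also have "(\<Sum>i<k. ?f (n + k) i) = (\<Sum>i<k. (int n + int k - 1)\<^sup>2 + 2 * int i)"
    by (intro sum.cong) (auto simp: max_deg_def)
  also have "\<dots> = int k * (int n + int k - 1)\<^sup>2 + int k * (int k - 1)"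
    using sum_lessThan_int[of k] by (simp add: sum.distrib sum_distrib_left[symmetric])
  finally show ?thesis by simp
qed

text \<open>Induction on the number of full blocks. For \<open>q = 0\<close> the digraph is complete
  on \<open>r\<close> vertices and the formula reduces to \<open>r^3 - r^2\<close>.\<close>

lemma max_energy_closed_form:
  assumes r: "r < k"
  shows "real_of_int (max_energy k (q * k + r))
    = 1/3 * real (q * k + r) ^ 3 + (real k / 2 - 1) * real (q * k + r) ^ 2
      + real k ^ 2 / 6 * real (q * k + r)
      + 2/3 * real r ^ 3 - real k / 2 * real r ^ 2 - real k ^ 2 / 6 * real r"
proof (induction q)
  case 0
  have "max_energy k r = (\<Sum>i<r. (int r - 1)\<^sup>2 + 2 * int i)"
    unfolding max_energy_def using r by (intro sum.cong) (auto simp: max_deg_def)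
  also have "\<dots> = int r * (int r - 1)\<^sup>2 + int r * (int r - 1)"
    using sum_lessThan_int[of r] by (simp add: sum.distrib sum_distrib_left[symmetric])
  finally have "real_of_int (max_energy k r) = real r * (real r - 1)\<^sup>2 + real r * (real r - 1)"
    by simp
  then show ?case by (simp add: power2_eq_square power3_eq_cube field_simps)
next
  case (Suc q)
  have n: "Suc q * k + r = (q * k + r) + k" by simp
  have "real_of_int (max_energy k (Suc q * k + r)) = real_of_int (max_energy k (q * k + r))
      + real k * (real (q * k + r) + real k - 1) ^ 2 + real k * (real k - 1)"
    unfolding n using r by (subst max_energy_add_block) auto
  then show ?case unfolding Suc n of_nat_add
    by (simp add: power2_eq_square power3_eq_cube field_simps)
qed

section \<open>Identification with the block digraphs\<close>

lemma block_enumeration: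
  assumes k: "1 \<le> k" and c: "\<And>i. i < n div k \<Longrightarrow> c (Suc i) = k"
    and m: "m = (if n mod k = 0 then n div k else Suc (n div k))"
    and last: "n mod k \<noteq> 0 \<Longrightarrow> c (Suc (n div k)) = n mod k"
  shows "bij_betw (\<lambda>i. (Suc (i div k), i mod k)) {..<n} (SIGMA i:{1..m}. {..<c i})"
proof (rule bij_betwI[where g = "\<lambda>p. (fst p - 1) * k + snd p"])
  show "(\<lambda>i. (Suc (i div k), i mod k)) \<in> {..<n} \<rightarrow> (SIGMA i:{1..m}. {..<c i})"
  proof
    fix i assume "i \<in> {..<n}"
    then have i: "i < n" by simp
    then have "i div k \<le> n div k" by (simp add: div_le_mono)
    then consider "i div k < n div k" | "i div k = n div k" by linarith
    then show "(Suc (i div k), i mod k) \<in> (SIGMA i:{1..m}. {..<c i})"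
    proof cases
      case 1
      then show ?thesis using c k m by auto
    next
      case 2
      then have "i mod k < n mod k"
        using i div_mult_mod_eq[of i k] div_mult_mod_eq[of n k] by (metis nat_add_left_cancel_less)
      then show ?thesis using 2 last m by auto
    qed
  qed
  show "(\<lambda>p. (fst p - 1) * k + snd p) \<in> (SIGMA i:{1..m}. {..<c i}) \<rightarrow> {..<n}"
  proof
    fix p assume "p \<in> (SIGMA i:{1..m}. {..<c i})"
    then obtain a b where p: "p = (Suc a, b)" "Suc a \<le> m" "b < c (Suc a)"
      by (cases p; cases "fst p") auto
    show "(fst p - 1) * k + snd p \<in> {..<n}"
    proof (cases "a < n div k")
      case True
      then have "Suc a * k \<le> n div k * k" by (intro mult_le_mono1) simp
      moreover have "b < k" using c[OF True] p by simp
      ultimately have "a * k + b < n" using div_times_less_eq_dividend[of n k] unfolding mult_Suc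
        by linarith
      then show ?thesis using p by simp
    next
      case False
      then have "n mod k \<noteq> 0" "a = n div k" using m p by (auto split: if_splits)
      then have "b < n mod k" using last p by simp
      then have "n div k * k + b < n div k * k + n mod k" by (rule add_strict_left_mono)
      then show ?thesis using p \<open>a = n div k\<close> by simp
    qed
  qed
  show "(fst (Suc (i div k), i mod k) - 1) * k + snd (Suc (i div k), i mod k) = i" for i by simp
  fix p assume "p \<in> (SIGMA i:{1..m}. {..<c i})"
  then obtain a b where p: "p = (Suc a, b)" "Suc a \<le> m" "b < c (Suc a)"
    by (cases p; cases "fst p") auto
  have "b < k"
  proof (cases "a < n div k")
    case True
    then show ?thesis using c p by simp
  next
    case False
    then have "n mod k \<noteq> 0" "a = n div k" using m p by (auto split: if_splits)
    then have "b < n mod k" using last p by simp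
    then show ?thesis using k by (metis less_trans mod_less_divisor not_gr_zero not_one_le_zero)
  qed
  then show "(Suc (((fst p - 1) * k + snd p) div k), ((fst p - 1) * k + snd p) mod k) = p"
    using p(1) by simp
qed

lemma (in digraph) digraph_iso_block_digraph_iff:
  assumes k: "1 \<le> k" and c: "\<And>i. i < n div k \<Longrightarrow> c (Suc i) = k"
    and m: "m = (if n mod k = 0 then n div k else Suc (n div k))"
    and last: "n mod k \<noteq> 0 \<Longrightarrow> c (Suc (n div k)) = n mod k"
  shows "digraph_iso G (block_digraph m c) \<longleftrightarrow> (\<exists>v. bij_betw v {..<n} (verts G) \<and>
    (\<forall>i<n. \<forall>j<n. arc_rel G (v i) (v j) \<longleftrightarrow> i \<noteq> j \<and> i div k \<le> j div k))"
proof -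
  define W where "W = (SIGMA i:{1..m}. {..<c i})"
  define R where "R = {(u, w). u \<in> W \<and> w \<in> W \<and> u \<noteq> w \<and> fst u \<le> fst w}"
  define b where "b i = (Suc (i div k), i mod k)" for i
  have b: "bij_betw b {..<n} W"
    unfolding b_def[abs_def] W_def by (rule block_enumeration[of k n c m, OF k c m last])
  have bW: "b i \<in> W" if "i < n" for i using b that by (auto simp: bij_betw_def)
  have b_inj: "b i = b j \<longleftrightarrow> i = j" if "i < n" "j < n" for i j
    using b that by (auto simp: bij_betw_def inj_on_def)
  have bR: "(b i, b j) \<in> R \<longleftrightarrow> i \<noteq> j \<and> i div k \<le> j div k" if "i < n" "j < n" for i j
    using bW b_inj that by (auto simp: R_def) (auto simp: b_def)
  have "block_digraph m c = with_proj \<lparr>pverts = W, parcs = R\<rparr>"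
    by (simp add: block_digraph_def W_def R_def Let_def)
  moreover have "R \<subseteq> W \<times> W" by (auto simp: R_def)
  ultimately have "digraph_iso G (block_digraph m c) \<longleftrightarrow>
    (\<exists>f. bij_betw f (verts G) W \<and> (\<forall>x\<in>verts G. \<forall>y\<in>verts G. arc_rel G x y \<longleftrightarrow> (f x, f y) \<in> R))"
    using digraph_iso_with_proj_iff by simp
  also have "\<dots> \<longleftrightarrow> (\<exists>v. bij_betw v {..<n} (verts G) \<and>
    (\<forall>i<n. \<forall>j<n. arc_rel G (v i) (v j) \<longleftrightarrow> i \<noteq> j \<and> i div k \<le> j div k))"
  proof
    assume "\<exists>f. bij_betw f (verts G) W \<and> (\<forall>x\<in>verts G. \<forall>y\<in>verts G. arc_rel G x y \<longleftrightarrow> (f x, f y) \<in> R)"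
    then obtain f where f: "bij_betw f (verts G) W"
      "\<And>x y. \<lbrakk>x \<in> verts G; y \<in> verts G\<rbrakk> \<Longrightarrow> arc_rel G x y \<longleftrightarrow> (f x, f y) \<in> R" by blast
    define v where "v = the_inv_into (verts G) f \<circ> b"
    have v: "bij_betw v {..<n} (verts G)"
      unfolding v_def by (rule bij_betw_trans[OF b bij_betw_the_inv_into[OF f(1)]])
    have "f (v i) = b i" if "i < n" for i
      using f(1) bW[OF that] by (simp add: v_def f_the_inv_into_f_bij_betw)
    then have "arc_rel G (v i) (v j) \<longleftrightarrow> i \<noteq> j \<and> i div k \<le> j div k" if "i < n" "j < n" for i j
      using f(2)[of "v i" "v j"] bR[OF that] v that by (auto simp: bij_betw_def)
    then show "\<exists>v. bij_betw v {..<n} (verts G) \<and>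
      (\<forall>i<n. \<forall>j<n. arc_rel G (v i) (v j) \<longleftrightarrow> i \<noteq> j \<and> i div k \<le> j div k)" using v by blast
  next
    assume "\<exists>v. bij_betw v {..<n} (verts G) \<and>
      (\<forall>i<n. \<forall>j<n. arc_rel G (v i) (v j) \<longleftrightarrow> i \<noteq> j \<and> i div k \<le> j div k)"
    then obtain v where v: "bij_betw v {..<n} (verts G)"
      "\<And>i j. \<lbrakk>i < n; j < n\<rbrakk> \<Longrightarrow> arc_rel G (v i) (v j) \<longleftrightarrow> i \<noteq> j \<and> i div k \<le> j div k" by blast
    define f where "f = b \<circ> the_inv_into {..<n} v"
    have f: "bij_betw f (verts G) W"
      unfolding f_def by (rule bij_betw_trans[OF bij_betw_the_inv_into[OF v(1)] b])
    have fv: "f (v i) = b i" if "i < n" for i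
      using v(1) that by (simp add: f_def bij_betw_def the_inv_into_f_f)
    have "arc_rel G x y \<longleftrightarrow> (f x, f y) \<in> R" if xy: "x \<in> verts G" "y \<in> verts G" for x y
    proof -
      obtain i j where ij: "i < n" "j < n" "x = v i" "y = v j"
        using xy bij_betw_imp_surj_on[OF v(1)] by (metis imageE lessThan_iff)
      then show ?thesis using v(2) fv bR by simp
    qed
    then show "\<exists>f. bij_betw f (verts G) W \<and>
      (\<forall>x\<in>verts G. \<forall>y\<in>verts G. arc_rel G x y \<longleftrightarrow> (f x, f y) \<in> R)" using f by blast
  qed
  finally show ?thesis .
qed

definition extremal_digraph :: "nat \<Rightarrow> nat \<Rightarrow> (nat, nat \<times> nat) pre_digraph" where
  "extremal_digraph k n = with_proj \<lparr>pverts = {..<n},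
     parcs = {(i, j). i < n \<and> j < n \<and> i \<noteq> j \<and> i div k \<le> j div k}\<rparr>"

lemma extremal_digraph_sel:
  "verts (extremal_digraph k n) = {..<n}"
  "arcs (extremal_digraph k n) = {(i, j). i < n \<and> j < n \<and> i \<noteq> j \<and> i div k \<le> j div k}"
  "tail (extremal_digraph k n) = fst" "head (extremal_digraph k n) = snd"
  "arcs_ends (extremal_digraph k n) = {(i, j). i < n \<and> j < n \<and> i \<noteq> j \<and> i div k \<le> j div k}"
  by (simp_all add: extremal_digraph_def)

lemma digraph_extremal: "digraph (extremal_digraph k n)"
proof unfold_locales
  have "arcs (extremal_digraph k n) \<subseteq> {..<n} \<times> {..<n}" by (auto simp: extremal_digraph_sel)
  then show "finite (arcs (extremal_digraph k n))" by (rule finite_subset) simp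
qed (auto simp: extremal_digraph_sel arc_to_ends_def)

lemma connected_extremal:
  assumes "0 < n"
  shows "Digraph_Component.connected (extremal_digraph k n)"
  unfolding connected_def strongly_connected_def
proof (intro conjI ballI)
  show "verts (with_proj (mk_symmetric (extremal_digraph k n))) \<noteq> {}"
    using assms by (simp add: extremal_digraph_sel lessThan_empty_iff)
  fix i j assume ij: "i \<in> verts (with_proj (mk_symmetric (extremal_digraph k n)))"
    "j \<in> verts (with_proj (mk_symmetric (extremal_digraph k n)))"
  have "i = j \<or> (i, j) \<in> parcs (mk_symmetric (extremal_digraph k n))"
    using ij nat_le_linear[of "i div k" "j div k"]
    by (auto simp: parcs_mk_symmetric extremal_digraph_sel)
  then show "i \<rightarrow>\<^sup>*\<^bsub>with_proj (mk_symmetric (extremal_digraph k n))\<^esub> j"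
    using ij unfolding reachable_def by (auto intro: rtrancl_on_into_rtrancl_on)
qed

lemma cycle_free_extremal:
  assumes "1 \<le> k"
  shows "cycle_free (arc_rel (extremal_digraph k n)) {..<n} (Suc k)"
  unfolding cycle_free_def
proof
  assume "\<exists>c. dcyc (arc_rel (extremal_digraph k n)) c (Suc k) \<and> c ` {..<Suc k} \<subseteq> {..<n}"
  then obtain c where c: "dcyc (arc_rel (extremal_digraph k n)) c (Suc k)" by blast
  have step: "c i div k \<le> c (Suc i mod Suc k) div k" if "i < Suc k" for i
    using c that assms by (auto simp: dcyc_def extremal_digraph_sel)
  have up: "c 0 div k \<le> c i div k" if "i \<le> k" for i
    using that
  proof (induction i)
    case (Suc i)
    then show ?case using step[of i] by simp
  qed simp
  have down: "c i div k \<le> c k div k" if "i \<le> k" for i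
    using that
  proof (induction "k - i" arbitrary: i)
    case (Suc d)
    then have "i < k" by simp
    then have "c i div k \<le> c (Suc i) div k" using step[of i] by simp
    also have "\<dots> \<le> c k div k" using Suc by (intro Suc.hyps) auto
    finally show ?case .
  qed simp
  have eq: "c 0 div k = c i div k" if "i < Suc k" for i
    using up[of i] down[of i] step[of k] that by simp
  have block: "c i \<in> {c 0 div k * k..<c 0 div k * k + k}" if "i < Suc k" for i
    unfolding eq[OF that] using assms div_times_less_eq_dividend[of "c i" k] dividend_less_div_times[of k "c i"]
    by (simp add: add.commute)
  have "c ` {..<Suc k} \<subseteq> {c 0 div k * k..<c 0 div k * k + k}"
    using block by (auto simp del: atLeastLessThan_iff)
  then have "card (c ` {..<Suc k}) \<le> k" 
    using card_mono[of "{c 0 div k * k..<c 0 div k * k + k}" "c ` {..<Suc k}"] by simp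
  then show False using dcyc_card[OF c] by simp
qed

theorem theorem1p4:
  fixes n k q r :: nat and M :: real
  assumes "0 < n" and "3 \<le> k" and "n = q * k + r" and "r < k"
    and "M = 1/3 * real n ^ 3 + (real k / 2 - 1) * real n ^ 2 + real k ^ 2 / 6 * real n
           + 2/3 * real r ^ 3 - real k / 2 * real r ^ 2 - real k ^ 2 / 6 * real r"
  shows "(\<forall>G :: ('a,'b) pre_digraph.
            digraph G \<and> card (verts G) = n \<and> is_free_of G (dicycle (k + 1))
            \<longrightarrow> laplacian_energy G \<le> M)
       \<and> (\<exists>G :: (nat, nat \<times> nat) pre_digraph.
            digraph G \<and> Digraph_Component.connected G \<and> card (verts G) = n
            \<and> is_free_of G (dicycle (k + 1)) \<and> laplacian_energy G = M)
       \<and> (\<forall>G :: ('a,'b) pre_digraph.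
            digraph G \<and> card (verts G) = n \<and> is_free_of G (dicycle (k + 1))
            \<longrightarrow> (laplacian_energy G = M
                 \<longleftrightarrow> (if r = 0 then digraph_iso G (F0_digraph n k)
                      else digraph_iso G (F_digraph n k (q + 1)))))"
proof -
  have M: "M = real_of_int (max_energy k n)"
    using max_energy_closed_form[OF assms(4), of q] assms(3,5) by simp
  have k1: "1 \<le> k" and n1: "1 \<le> n" using assms(1,2) by simp_all
  have dm: "n div k = q" "n mod k = r" using assms by auto
  have free_iff: "is_free_of G (dicycle (k + 1)) \<longleftrightarrow> cycle_free (arc_rel G) (verts G) (Suc k)"
    if "digraph G" for G :: "('c, 'd) pre_digraph"
    using digraph.is_free_of_dicycle_iff[OF that, of "k + 1"] k1 by simp
  have LE: "laplacian_energy G \<le> M"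
    and LE_eq: "laplacian_energy G = M \<longleftrightarrow> (\<exists>v. bij_betw v {..<n} (verts G) \<and>
      (\<forall>i<n. \<forall>j<n. arc_rel G (v i) (v j) \<longleftrightarrow> i \<noteq> j \<and> i div k \<le> j div k))"
    if G: "digraph G" "card (verts G) = n" "is_free_of G (dicycle (k + 1))"
    for G :: "('c, 'd) pre_digraph"
  proof -
    interpret digraph G by (rule G(1))
    note e = energy_cycle_free[where E = "arc_rel G", OF arc_rel_irrefl finite_verts assms(2) _ G(2) n1]
    show "laplacian_energy G \<le> M"
      using e(1) free_iff[OF G(1)] G(3) by (simp add: laplacian_energy_eq_energy M)
    show "laplacian_energy G = M \<longleftrightarrow> (\<exists>v. bij_betw v {..<n} (verts G) \<and>
      (\<forall>i<n. \<forall>j<n. arc_rel G (v i) (v j) \<longleftrightarrow> i \<noteq> j \<and> i div k \<le> j div k))"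
      using e(2) free_iff[OF G(1)] G(3) by (simp add: laplacian_energy_eq_energy M)
  qed
  have iso: "(if r = 0 then digraph_iso G (F0_digraph n k) else digraph_iso G (F_digraph n k (q + 1)))
      \<longleftrightarrow> (\<exists>v. bij_betw v {..<n} (verts G) \<and>
        (\<forall>i<n. \<forall>j<n. arc_rel G (v i) (v j) \<longleftrightarrow> i \<noteq> j \<and> i div k \<le> j div k))"
    if "digraph G" for G :: "('c, 'd) pre_digraph"
  proof -
    interpret digraph G by (rule that)
    show ?thesis
    proof (cases "r = 0")
      case True
      then show ?thesis unfolding F0_digraph_def
        using digraph_iso_block_digraph_iff[OF k1, of n "\<lambda>i. k" "n div k"] dm by simp
    next
      case False
      then show ?thesis unfolding F_digraph_def
        using digraph_iso_block_digraph_iff[OF k1, of n "\<lambda>i. if i = q + 1 then n mod k else k" "n div k + 1"]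
          dm by simp
    qed
  qed
  let ?H = "extremal_digraph k n"
  have H: "digraph ?H" "Digraph_Component.connected ?H" "card (verts ?H) = n" "is_free_of ?H (dicycle (k + 1))"
    using digraph_extremal connected_extremal assms(1) cycle_free_extremal[OF k1] free_iff[of ?H]
    by (simp_all add: extremal_digraph_sel)
  have HM: "laplacian_energy ?H = M"
    unfolding LE_eq[OF H(1,3,4)]
    by (rule exI[of _ "\<lambda>i. i"]) (simp add: extremal_digraph_sel bij_betw_def)
  show ?thesis
  proof (intro conjI allI impI, goal_cases)
    case (1 G)
    then show ?case using LE[of G] by blast
  next
    case 2
    show ?case using H HM by (intro exI[of _ ?H] conjI)
  next
    case (3 G)
    then show ?case using LE_eq[of G] iso[of G] by simp
  qed
qed

end
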